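(* Let $G$ be a locally convex Lie group and let $f\colon M\to N$ be a smooth $G$-equivariant map between (locally convex) $G$-manifolds. Let $\mu\in N$ be such that $M_\mu:=f^{-1}(\mu)$ is not empty and that the stabilizer subgroup $G_\mu$ of $\mu$ is a Lie subgroup of $G$. If $f$ can be brought into an equivariant normal form at every point of $M_\mu$, then there exists a Kuranishi chart on $\check M_\mu:=f^{-1}(\mu)/G_\mu$ (with the quotient topology) at every point.
   Context: Manifolds are smooth, modeled on locally convex spaces. A $G$-manifold carries a smooth $G$-action. Kuranishi chart at a point $x$ of a topological space $X$: a tuple $(V,E,F,H,s,\kappa)$ consisting of an open neighborhood $V$ of $0$ in a locally convex space $E$, a locally convex space $F$, a compact Lie group $H$ acting linearly and continuously on $V$ and $F$, a smooth $H$-equivariant map $s\colon V\to F$, and a homeomorphism $\kappa$ from $s^{-1}(0)/H$ to a neighborhood of $x$ in $X$. Slice at $m$ for the $G_\mu$-action: a submanifold $S\ni m$ with: (SL1) $G_m\cdot S\subseteq S$; (SL2) if $g\in G_\mu$ and $(g\cdot S)\cap S\ne\emptyset$ then $g\in G_m$; (SL3) $G_m$ is a Lie subgroup for which $G_\mu\to G_\mu/G_m$ is a locally trivial principal bundle, admitting a local section $\chi\colon W\to G_\mu$ on an open neighborhood $W$ of $[e]$ such that $W\times S\to M$, $([g],s)\mapsto\chi([g])\cdot s$ is a diffeomorphism onto an open neighborhood of $m$; (SL4) $\{s\in S:(G_\mu)_s\text{ conjugate to }G_m\}$ is a closed submanifold of $S$; (SL5) there are a continuous representation of $G_m$ on a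 locally convex space $X$ and a $G_m$-equivariant diffeomorphism $\iota_S$ from a $G_m$-invariant open neighborhood of $0\in X$ onto $S$ with $\iota_S(0)=m$. The tube map $\chi^T\colon G_\mu\times_{G_m}S\to M$, $[g,s]\mapsto g\cdot s$ is a $G_\mu$-equivariant diffeomorphism onto an open $G_\mu$-invariant neighborhood of $G_\mu\cdot m$. Abstract equivariant normal form: a tuple $(H,X,Y,\hat f,f_{\mathrm{sing}})$ with $H$ a compact Lie group; $X,Y$ locally convex spaces with linear $H$-actions and $H$-invariant topological direct sums $X=\mathrm{Ker}\oplus\mathrm{Coim}$, $Y=\mathrm{Coker}\oplus\mathrm{Im}$; $\hat f\colon\mathrm{Coim}\to\mathrm{Im}$ an $H$-equivariant linear topological isomorphism; $f_{\mathrm{sing}}\colon U\to\mathrm{Coker}$ smooth and $H$-equivariant on an $H$-invariant open neighborhood $U$ of $0\in X$ with $f_{\mathrm{sing}}(0,x_2)=0$ for $x_2\in U\cap\mathrm{Coim}$ and $T_0f_{\mathrm{sing}}=0$. Set $f_{\mathrm{NF}}\colon G_\mu\times_HU\to G_\mu\times_HY$, $f_{\mathrm{NF}}([g,x_1,x_2])=[g,\hat f(x_2)+f_{\mathrm{sing}}(x_1,x_2)]$. The map $f$ can be brought into an equivariant normal form at $m\in f^{-1}(\mu)$ if for some such tuple with $H=G_m$ there exist a slice $S$ at $m$ for the $G_\mu$-action, a $G_m$-equivariant diffeomorphism $\iota_S\colon X\supseteq U\to S$, and a $G_m$-equivariant chart $\rho\colon N\supseteq V'\to V\subseteq Y$ at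 $\mu$ (with $\rho(\mu)=0$) with $f(S)\subseteq V'$, such that $f\circ\chi^T\circ(\mathrm{id}_{G_\mu}\times\iota_S)=\rho^T\circ f_{\mathrm{NF}}$ on $G_\mu\times_{G_m}U$, where $\rho^T([g,y])=g\cdot\rho^{-1}(y)$. *)

theory Defs
  imports "HOL-Analysis.Analysis" "HOL-Algebra.Group_Action" "HOL-Algebra.Left_Coset"
begin

section \<open>Locally convex spaces\<close>

text \<open>
  A class of (Hausdorff) locally convex spaces. Individual locally convex spaces are linear
  subspaces \<open>E\<close> of a type of this class with the induced topology \<open>top_of_set E\<close>. Since every
  set-indexed family of locally convex spaces embeds linearly and homeomorphically into its product,
  one type is large enough to hold any given family, and quantification over locally convex spaces
  is rendered as quantification over the linear subspaces of an arbitrary such type.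
\<close>

text \<open>
  Continuity of the vector space operations is assumed directly rather than by extending
  \<open>topological_ab_group_add\<close>: the library's product instances of that class are for normed spaces only
  and would rule out the product instance below.
\<close>

class locally_convex_space = real_vector + t2_space +
  assumes tendsto_add_nhds_lcs:
    "((\<lambda>p. fst p + snd p) \<longlongrightarrow> x + y) (nhds x \<times>\<^sub>F nhds y)"
  assumes tendsto_scaleR_nhds_lcs:
    "((\<lambda>p. fst p *\<^sub>R snd p) \<longlongrightarrow> r *\<^sub>R x) (nhds r \<times>\<^sub>F nhds x)"
  assumes convex_nhd_base:
    "open U \<Longrightarrow> 0 \<in> U \<Longrightarrow>
      \<exists>C. open C \<and> 0 \<in> C \<and> C \<subseteq> U \<and>
          (\<forall>x\<in>C. \<forall>y\<in>C. \<forall>t. 0 \<le> t \<and> t \<le> 1 \<longrightarrow> (1 - t) *\<^sub>R x + t *\<^sub>R y \<in> C)"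

instance real_normed_vector \<subseteq> locally_convex_space
proof
  fix x y :: 'a
  show "((\<lambda>p. fst p + snd p) \<longlongrightarrow> x + y) (nhds x \<times>\<^sub>F nhds y)"
    by (rule tendsto_add_Pair)
next
  fix r :: real and x :: 'a
  show "((\<lambda>p. fst p *\<^sub>R snd p) \<longlongrightarrow> r *\<^sub>R x) (nhds r \<times>\<^sub>F nhds x)"
    by (intro tendsto_scaleR filterlim_fst filterlim_snd)
next
  fix U :: "'a set"
  assume "open U" "0 \<in> U"
  then obtain e where e: "e > 0" "ball 0 e \<subseteq> U"
    using open_contains_ball by blast
  have "(1 - t) *\<^sub>R x + t *\<^sub>R y \<in> ball 0 e"
    if "x \<in> ball 0 e" "y \<in> ball 0 e" "0 \<le> t" "t \<le> 1" for x y :: 'a and t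
    using convexD_alt[OF convex_ball that(1,2,3,4)] .
  then show "\<exists>C. open C \<and> 0 \<in> C \<and> C \<subseteq> U \<and>
          (\<forall>x\<in>C. \<forall>y\<in>C. \<forall>t. 0 \<le> t \<and> t \<le> 1 \<longrightarrow> (1 - t) *\<^sub>R x + t *\<^sub>R y \<in> C)"
    using e by (intro exI[of _ "ball 0 e"]) auto
qed

lemma tendsto_add_lcs:
  fixes f g :: "'b \<Rightarrow> 'a::locally_convex_space"
  assumes "(f \<longlongrightarrow> x) F" "(g \<longlongrightarrow> y) F"
  shows "((\<lambda>z. f z + g z) \<longlongrightarrow> x + y) F"
  using filterlim_compose[OF tendsto_add_nhds_lcs, of "\<lambda>z. (f z, g z)" x y F] assms
  by (simp add: nhds_prod[symmetric] tendsto_Pair)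

lemma tendsto_scaleR_lcs:
  fixes g :: "'b \<Rightarrow> 'a::locally_convex_space"
  assumes "(f \<longlongrightarrow> r) F" "(g \<longlongrightarrow> x) F"
  shows "((\<lambda>z. f z *\<^sub>R g z) \<longlongrightarrow> r *\<^sub>R x) F"
  using filterlim_compose[OF tendsto_scaleR_nhds_lcs, of "\<lambda>z. (f z, g z)" r x F] assms
  by (simp add: nhds_prod[symmetric] tendsto_Pair)

instance prod :: (locally_convex_space, locally_convex_space) locally_convex_space
proof
  fix x y :: "'a \<times> 'b"
  have f: "((\<lambda>p. fst p) \<longlongrightarrow> x) (nhds x \<times>\<^sub>F nhds y)" "((\<lambda>p. snd p) \<longlongrightarrow> y) (nhds x \<times>\<^sub>F nhds y)"
    by (auto intro: filterlim_fst filterlim_snd)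
  show "((\<lambda>p. fst p + snd p) \<longlongrightarrow> x + y) (nhds x \<times>\<^sub>F nhds y)"
    unfolding plus_prod_def
    by (intro tendsto_Pair tendsto_add_lcs tendsto_fst tendsto_snd f)
next
  fix r :: real and x :: "'a \<times> 'b"
  have f: "((\<lambda>p. fst p) \<longlongrightarrow> r) (nhds r \<times>\<^sub>F nhds x)" "((\<lambda>p. snd p) \<longlongrightarrow> x) (nhds r \<times>\<^sub>F nhds x)"
    by (auto intro: filterlim_fst filterlim_snd)
  show "((\<lambda>p. fst p *\<^sub>R snd p) \<longlongrightarrow> r *\<^sub>R x) (nhds r \<times>\<^sub>F nhds x)"
    unfolding scaleR_prod_def
    by (intro tendsto_Pair tendsto_scaleR_lcs tendsto_fst tendsto_snd f)
next
  fix U :: "('a \<times> 'b) set"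
  assume "open U" "0 \<in> U"
  then obtain A B where AB: "open A" "open B" "(0::'a) \<in> A" "(0::'b) \<in> B" "A \<times> B \<subseteq> U"
    by (metis mem_Sigma_iff open_prod_elim zero_prod_def)
  obtain C where C: "open C" "0 \<in> C" "C \<subseteq> A"
      "\<forall>x\<in>C. \<forall>y\<in>C. \<forall>t. 0 \<le> t \<and> t \<le> 1 \<longrightarrow> (1 - t) *\<^sub>R x + t *\<^sub>R y \<in> C"
    using convex_nhd_base[OF AB(1,3)] by blast
  obtain D where D: "open D" "0 \<in> D" "D \<subseteq> B"
      "\<forall>x\<in>D. \<forall>y\<in>D. \<forall>t. 0 \<le> t \<and> t \<le> 1 \<longrightarrow> (1 - t) *\<^sub>R x + t *\<^sub>R y \<in> D"
    using convex_nhd_base[OF AB(2,4)] by blast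
  show "\<exists>C. open C \<and> 0 \<in> C \<and> C \<subseteq> U \<and>
          (\<forall>x\<in>C. \<forall>y\<in>C. \<forall>t. 0 \<le> t \<and> t \<le> 1 \<longrightarrow> (1 - t) *\<^sub>R x + t *\<^sub>R y \<in> C)"
    using C D AB(5)
    by (intro exI[of _ "C \<times> D"]) (auto simp: open_Times zero_prod_def)
qed

definition linear_between ::
  "'a::real_vector set \<Rightarrow> 'b::real_vector set \<Rightarrow> ('a \<Rightarrow> 'b) \<Rightarrow> bool" where
  "linear_between X Y A \<longleftrightarrow> A ` X \<subseteq> Y \<and>
     (\<forall>x\<in>X. \<forall>y\<in>X. A (x + y) = A x + A y) \<and> (\<forall>x\<in>X. \<forall>r. A (r *\<^sub>R x) = r *\<^sub>R A x)"

definition topological_direct_sum ::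
  "'a::{real_vector,topological_space} set \<Rightarrow> 'a set \<Rightarrow> 'a set \<Rightarrow> bool" where
  "topological_direct_sum X A B \<longleftrightarrow> subspace X \<and> subspace A \<and> subspace B \<and>
     homeomorphic_map (top_of_set (A \<times> B)) (top_of_set X) (\<lambda>(a, b). a + b)"

text \<open>The component in \<open>B\<close> of \<open>x \<in> A \<oplus> B\<close>.\<close>

definition second_component :: "'a::real_vector set \<Rightarrow> 'a set \<Rightarrow> 'a \<Rightarrow> 'a" where
  "second_component A B x = (THE b. b \<in> B \<and> x - b \<in> A)"


section \<open>Smooth maps\<close>

text \<open>
  Calculus in the sense of Michal and Bastiani. A map \<open>f\<close> on a relatively open subset \<open>U\<close> of \<open>E\<close> with
  values in \<open>F\<close> is smooth if all iterated directional derivatives exist in \<open>F\<close> and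
  \<open>(x, v\<^sub>1, \<dots>, v\<^sub>n) \<mapsto> d\<^sup>n f(x; v\<^sub>1, \<dots>, v\<^sub>n)\<close> is continuous on \<open>U \<times> E\<^sup>n\<close> for every \<open>n\<close>. The argument
  \<open>(v\<^sub>1, \<dots>, v\<^sub>n)\<close> is read off from the first \<open>n\<close> entries of a sequence, the space of sequences
  carrying the product topology.
\<close>

primrec iter_deriv ::
  "('a::real_vector \<Rightarrow> 'b::locally_convex_space) \<Rightarrow> 'a list \<Rightarrow> 'a \<Rightarrow> 'b" where
  "iter_deriv f [] x = f x"
| "iter_deriv f (v # vs) x =
     Lim (at (0::real)) (\<lambda>t. (1 / t) *\<^sub>R (iter_deriv f vs (x + t *\<^sub>R v) - iter_deriv f vs x))"

definition smooth_on ::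
  "'a::locally_convex_space set \<Rightarrow> 'b::locally_convex_space set \<Rightarrow> 'a set \<Rightarrow> ('a \<Rightarrow> 'b) \<Rightarrow> bool" where
  "smooth_on E F U f \<longleftrightarrow> f ` U \<subseteq> F \<and>
     (\<forall>vs x v. set vs \<subseteq> E \<and> x \<in> U \<and> v \<in> E \<longrightarrow>
        (\<exists>l\<in>F. ((\<lambda>t. (1 / t) *\<^sub>R (iter_deriv f vs (x + t *\<^sub>R v) - iter_deriv f vs x)) \<longlongrightarrow> l)
                 (at (0::real)))) \<and>
     (\<forall>n. continuous_on (U \<times> {v :: nat \<Rightarrow> 'a. \<forall>i. v i \<in> E})
            (\<lambda>(x, v). iter_deriv f (map v [0..<n]) x))"


section \<open>Manifolds\<close>

text \<open>A chart takes its values in the locally convex space \<open>cmodel c\<close>, which may vary with \<open>c\<close>.\<close>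

record ('m, 'e) chart =
  cdom :: "'m set"
  cmodel :: "'e set"
  cmap :: "'m \<Rightarrow> 'e"

record ('m, 'e) mfd =
  mtop :: "'m topology"
  atlas :: "('m, 'e) chart set"

abbreviation mpoints :: "('m, 'e) mfd \<Rightarrow> 'm set" where
  "mpoints M \<equiv> topspace (mtop M)"

definition chart_on :: "'m topology \<Rightarrow> ('m, 'e::locally_convex_space) chart \<Rightarrow> bool" where
  "chart_on T c \<longleftrightarrow> openin T (cdom c) \<and> subspace (cmodel c) \<and>
     openin (top_of_set (cmodel c)) (cmap c ` cdom c) \<and>
     homeomorphic_map (subtopology T (cdom c)) (top_of_set (cmap c ` cdom c)) (cmap c)"

definition smooth_transition ::
  "('m, 'e::locally_convex_space) chart \<Rightarrow> ('m, 'e) chart \<Rightarrow> bool" where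
  "smooth_transition c d \<longleftrightarrow>
     smooth_on (cmodel c) (cmodel d) (cmap c ` (cdom c \<inter> cdom d))
       (cmap d \<circ> inv_into (cdom c) (cmap c))"

definition manifold :: "('m, 'e::locally_convex_space) mfd \<Rightarrow> bool" where
  "manifold M \<longleftrightarrow> Hausdorff_space (mtop M) \<and>
     (\<forall>c\<in>atlas M. chart_on (mtop M) c) \<and>
     (\<Union>c\<in>atlas M. cdom c) = mpoints M \<and>
     (\<forall>c\<in>atlas M. \<forall>d\<in>atlas M. smooth_transition c d)"

definition max_atlas :: "('m, 'e::locally_convex_space) mfd \<Rightarrow> ('m, 'e) chart set" where
  "max_atlas M = {c. chart_on (mtop M) c \<and>
     (\<forall>d\<in>atlas M. smooth_transition c d \<and> smooth_transition d c)}"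

definition smooth_map ::
  "('m, 'e::locally_convex_space) mfd \<Rightarrow> ('n, 'f::locally_convex_space) mfd \<Rightarrow> ('m \<Rightarrow> 'n) \<Rightarrow> bool" where
  "smooth_map M N f \<longleftrightarrow> continuous_map (mtop M) (mtop N) f \<and>
     (\<forall>c\<in>atlas M. \<forall>d\<in>atlas N.
        smooth_on (cmodel c) (cmodel d) (cmap c ` (cdom c \<inter> f -` cdom d))
          (cmap d \<circ> f \<circ> inv_into (cdom c) (cmap c)))"

definition diffeomorphism ::
  "('m, 'e::locally_convex_space) mfd \<Rightarrow> ('n, 'f::locally_convex_space) mfd \<Rightarrow> ('m \<Rightarrow> 'n) \<Rightarrow> bool" where
  "diffeomorphism M N f \<longleftrightarrow> smooth_map M N f \<and> bij_betw f (mpoints M) (mpoints N) \<and>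
     smooth_map N M (inv_into (mpoints M) f)"

definition prod_mfd :: "('m, 'e) mfd \<Rightarrow> ('n, 'f) mfd \<Rightarrow> ('m \<times> 'n, 'e \<times> 'f) mfd" where
  "prod_mfd M N = \<lparr> mtop = prod_topology (mtop M) (mtop N),
     atlas = {\<lparr> cdom = cdom c \<times> cdom d, cmodel = cmodel c \<times> cmodel d,
                cmap = map_prod (cmap c) (cmap d) \<rparr> | c d. c \<in> atlas M \<and> d \<in> atlas N} \<rparr>"

definition open_mfd :: "'e::locally_convex_space set \<Rightarrow> 'e set \<Rightarrow> ('e, 'e) mfd" where
  "open_mfd E U = \<lparr> mtop = top_of_set U, atlas = {\<lparr> cdom = U, cmodel = E, cmap = (\<lambda>x. x) \<rparr>} \<rparr>"

text \<open>
  Embedded submanifolds: \<open>S\<close> is covered by charts of \<open>M\<close> which map it to a closed linear subspace.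
  The subspace is not required to be complemented. Open subsets are submanifolds.
\<close>

definition adapted_charts ::
  "('m, 'e::locally_convex_space) mfd \<Rightarrow> 'm set \<Rightarrow> ('m, 'e) chart set" where
  "adapted_charts M S =
     {\<lparr> cdom = cdom c \<inter> S, cmodel = F, cmap = cmap c \<rparr> | c F.
        c \<in> max_atlas M \<and> subspace F \<and> F \<subseteq> cmodel c \<and> closedin (top_of_set (cmodel c)) F \<and>
        cmap c ` (cdom c \<inter> S) = cmap c ` cdom c \<inter> F}"

definition submfd :: "('m, 'e::locally_convex_space) mfd \<Rightarrow> 'm set \<Rightarrow> ('m, 'e) mfd" where
  "submfd M S = \<lparr> mtop = subtopology (mtop M) S, atlas = adapted_charts M S \<rparr>"

definition submanifold :: "('m, 'e::locally_convex_space) mfd \<Rightarrow> 'm set \<Rightarrow> bool" where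
  "submanifold M S \<longleftrightarrow> S \<subseteq> mpoints M \<and> S \<subseteq> (\<Union>c\<in>adapted_charts M S. cdom c)"


section \<open>Lie groups and their actions\<close>

record ('g, 'e) lie = "'g monoid" +
  lmfd :: "('g, 'e) mfd"

abbreviation ltop :: "('g, 'e) lie \<Rightarrow> 'g topology" where
  "ltop G \<equiv> mtop (lmfd G)"

definition lie_group :: "('g, 'e::locally_convex_space) lie \<Rightarrow> bool" where
  "lie_group G \<longleftrightarrow> group G \<and> manifold (lmfd G) \<and> topspace (ltop G) = carrier G \<and>
     smooth_map (prod_mfd (lmfd G) (lmfd G)) (lmfd G) (\<lambda>(a, b). a \<otimes>\<^bsub>G\<^esub> b) \<and>
     smooth_map (lmfd G) (lmfd G) (\<lambda>a. inv\<^bsub>G\<^esub> a)"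

text \<open>
  A compact Lie group is automatically finite-dimensional, because a locally compact Hausdorff
  topological vector space is.
\<close>

definition compact_lie_group :: "('g, 'e::locally_convex_space) lie \<Rightarrow> bool" where
  "compact_lie_group G \<longleftrightarrow> lie_group G \<and> compact_space (ltop G)"

definition lie_subgroup :: "'g set \<Rightarrow> ('g, 'e::locally_convex_space) lie \<Rightarrow> bool" where
  "lie_subgroup H G \<longleftrightarrow> subgroup H G \<and> submanifold (lmfd G) H"

definition sub_lie :: "('g, 'e::locally_convex_space) lie \<Rightarrow> 'g set \<Rightarrow> ('g, 'e) lie" where
  "sub_lie G H = G\<lparr> carrier := H, lmfd := submfd (lmfd G) H \<rparr>"

definition g_manifold ::
  "('g, 'e::locally_convex_space) lie \<Rightarrow> ('m, 'f::locally_convex_space) mfd \<Rightarrow> ('g \<Rightarrow> 'm \<Rightarrow> 'm) \<Rightarrow> bool" where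
  "g_manifold G M \<phi> \<longleftrightarrow> manifold M \<and> group_action G (mpoints M) \<phi> \<and>
     smooth_map (prod_mfd (lmfd G) M) M (\<lambda>(g, x). \<phi> g x)"

definition invariant_under :: "('g, 'e) lie \<Rightarrow> ('g \<Rightarrow> 'a \<Rightarrow> 'a) \<Rightarrow> 'a set \<Rightarrow> bool" where
  "invariant_under H \<sigma> U \<longleftrightarrow> (\<forall>h\<in>carrier H. \<sigma> h ` U \<subseteq> U)"

definition equivariant_on ::
  "('g, 'e) lie \<Rightarrow> 'a set \<Rightarrow> ('g \<Rightarrow> 'a \<Rightarrow> 'a) \<Rightarrow> ('g \<Rightarrow> 'b \<Rightarrow> 'b) \<Rightarrow> ('a \<Rightarrow> 'b) \<Rightarrow> bool" where
  "equivariant_on H U \<sigma> \<tau> F \<longleftrightarrow> (\<forall>h\<in>carrier H. \<forall>x\<in>U. F (\<sigma> h x) = \<tau> h (F x))"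

definition linear_action ::
  "('g, 'e) lie \<Rightarrow> 'a::real_vector set \<Rightarrow> ('g \<Rightarrow> 'a \<Rightarrow> 'a) \<Rightarrow> bool" where
  "linear_action H X \<sigma> \<longleftrightarrow> subspace X \<and> group_action H X \<sigma> \<and>
     (\<forall>h\<in>carrier H. linear_between X X (\<sigma> h))"

definition continuous_representation ::
  "('g, 'e) lie \<Rightarrow> 'a::{real_vector,topological_space} set \<Rightarrow> ('g \<Rightarrow> 'a \<Rightarrow> 'a) \<Rightarrow> bool" where
  "continuous_representation H X \<sigma> \<longleftrightarrow> linear_action H X \<sigma> \<and>
     continuous_map (prod_topology (ltop H) (top_of_set X)) (top_of_set X) (\<lambda>(h, x). \<sigma> h x)"


section \<open>Kuranishi charts\<close>

definition quotient_topology :: "'a topology \<Rightarrow> ('a \<Rightarrow> 'b) \<Rightarrow> 'b topology" where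
  "quotient_topology T p =
     topology (\<lambda>W. W \<subseteq> p ` topspace T \<and> openin T {x \<in> topspace T. p x \<in> W})"

lemma openin_quotient_topology:
  "openin (quotient_topology T p) W \<longleftrightarrow>
     W \<subseteq> p ` topspace T \<and> openin T {x \<in> topspace T. p x \<in> W}"
proof -
  have "istopology (\<lambda>W. W \<subseteq> p ` topspace T \<and> openin T {x \<in> topspace T. p x \<in> W})"
    unfolding istopology_def
  proof (intro conjI allI impI)
    fix A B
    assume "A \<subseteq> p ` topspace T \<and> openin T {x \<in> topspace T. p x \<in> A}"
      "B \<subseteq> p ` topspace T \<and> openin T {x \<in> topspace T. p x \<in> B}"
    moreover have "{x \<in> topspace T. p x \<in> A \<inter> B} =
        {x \<in> topspace T. p x \<in> A} \<inter> {x \<in> topspace T. p x \<in> B}" by auto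
    ultimately show "A \<inter> B \<subseteq> p ` topspace T" "openin T {x \<in> topspace T. p x \<in> A \<inter> B}"
      by auto
  next
    fix \<K>
    assume *: "\<forall>K\<in>\<K>. K \<subseteq> p ` topspace T \<and> openin T {x \<in> topspace T. p x \<in> K}"
    have "{x \<in> topspace T. p x \<in> \<Union> \<K>} = (\<Union>K\<in>\<K>. {x \<in> topspace T. p x \<in> K})" by auto
    with * show "\<Union> \<K> \<subseteq> p ` topspace T" "openin T {x \<in> topspace T. p x \<in> \<Union> \<K>}"
      by auto
  qed
  then show ?thesis
    by (simp add: quotient_topology_def topology_inverse')
qed

lemma topspace_quotient_topology: "topspace (quotient_topology T p) = p ` topspace T"
proof
  show "topspace (quotient_topology T p) \<subseteq> p ` topspace T"
    using openin_quotient_topology[of T p "topspace (quotient_topology T p)"] by simp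
  have "{x \<in> topspace T. p x \<in> p ` topspace T} = topspace T" by auto
  then have "openin (quotient_topology T p) (p ` topspace T)"
    by (simp add: openin_quotient_topology)
  then show "p ` topspace T \<subseteq> topspace (quotient_topology T p)"
    by (rule openin_subset)
qed

lemma quotient_map_quotient_topology: "quotient_map T (quotient_topology T p) p"
  by (auto simp: quotient_map_def topspace_quotient_topology openin_quotient_topology)

abbreviation orbit_space ::
  "'a topology \<Rightarrow> ('g, 'e) lie \<Rightarrow> ('g \<Rightarrow> 'a \<Rightarrow> 'a) \<Rightarrow> 'a set topology" where
  "orbit_space T G \<phi> \<equiv> quotient_topology T (orbit G \<phi>)"

text \<open>
  The linear action of \<open>H\<close> on \<open>V\<close> is the restriction of a continuous representation \<open>\<sigma>\<close> of \<open>H\<close> on \<open>E\<close>;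
  \<open>\<tau>\<close> is the representation on \<open>F\<close>.
\<close>

definition kuranishi_chart ::
  "'q topology \<Rightarrow> 'q \<Rightarrow>
   'a::locally_convex_space set \<Rightarrow> 'a set \<Rightarrow> 'b::locally_convex_space set \<Rightarrow>
   ('g, 'e::locally_convex_space) lie \<Rightarrow> ('g \<Rightarrow> 'a \<Rightarrow> 'a) \<Rightarrow> ('g \<Rightarrow> 'b \<Rightarrow> 'b) \<Rightarrow>
   ('a \<Rightarrow> 'b) \<Rightarrow> ('a set \<Rightarrow> 'q) \<Rightarrow> bool" where
  "kuranishi_chart T x V E F H \<sigma> \<tau> s \<kappa> \<longleftrightarrow>
     subspace E \<and> openin (top_of_set E) V \<and> 0 \<in> V \<and> subspace F \<and>
     compact_lie_group H \<and>
     continuous_representation H E \<sigma> \<and> invariant_under H \<sigma> V \<and>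
     continuous_representation H F \<tau> \<and>
     smooth_on E F V s \<and> equivariant_on H V \<sigma> \<tau> s \<and>
     (\<exists>A B. openin T B \<and> x \<in> B \<and> B \<subseteq> A \<and> A \<subseteq> topspace T \<and>
        homeomorphic_map (orbit_space (top_of_set {v \<in> V. s v = 0}) H \<sigma>) (subtopology T A) \<kappa>)"


section \<open>Slices\<close>

text \<open>\<open>B\<close> is a manifold structure on \<open>K/H\<close> making \<open>K \<rightarrow> K/H\<close> a locally trivial principal \<open>H\<close>-bundle.\<close>

definition principal_bundle ::
  "('g, 'e::locally_convex_space) lie \<Rightarrow> 'g set \<Rightarrow> ('g set, 'e) mfd \<Rightarrow> bool" where
  "principal_bundle K H B \<longleftrightarrow>
     manifold B \<and> mpoints B = lcosets\<^bsub>K\<^esub> H \<and>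
     smooth_map (lmfd K) B (\<lambda>g. g <#\<^bsub>K\<^esub> H) \<and>
     (\<forall>b\<in>mpoints B. \<exists>W \<theta>. openin (mtop B) W \<and> b \<in> W \<and>
        diffeomorphism (prod_mfd (submfd B W) (lmfd (sub_lie K H)))
          (submfd (lmfd K) {g \<in> carrier K. g <#\<^bsub>K\<^esub> H \<in> W}) \<theta> \<and>
        (\<forall>w\<in>W. \<forall>h\<in>H. \<theta> (w, h) <#\<^bsub>K\<^esub> H = w) \<and>
        (\<forall>w\<in>W. \<forall>h\<in>H. \<forall>k\<in>H. \<theta> (w, h \<otimes>\<^bsub>K\<^esub> k) = \<theta> (w, h) \<otimes>\<^bsub>K\<^esub> k))"

text \<open>
  \<open>slice TYPE('x) K M \<phi> m S\<close>: \<open>S\<close> is a slice at \<open>m\<close> for the action \<open>\<phi>\<close> of \<open>K\<close> on \<open>M\<close>. The linear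
  representation on which \<open>S\<close> is modelled lives on a linear subspace of \<open>'x\<close>. That the charts of
  \<open>K/K\<^sub>m\<close> and of \<open>K\<close> take values in the same type \<open>'e\<close> is no restriction, since local sections embed
  \<open>K/K\<^sub>m\<close> locally into \<open>K\<close>. The tube map is then a diffeomorphism onto an open set; this is a
  consequence of the conditions and is not assumed.
\<close>

definition slice ::
  "'x::locally_convex_space itself \<Rightarrow> ('g, 'e::locally_convex_space) lie \<Rightarrow>
   ('m, 'f::locally_convex_space) mfd \<Rightarrow> ('g \<Rightarrow> 'm \<Rightarrow> 'm) \<Rightarrow> 'm \<Rightarrow> 'm set \<Rightarrow> bool" where
  "slice _ K M \<phi> m S \<longleftrightarrow>
     (let Km = stabilizer K \<phi> m in
      submanifold M S \<and> m \<in> S \<and>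
      (\<forall>g\<in>Km. \<phi> g ` S \<subseteq> S) \<and>
      (\<forall>g\<in>carrier K. \<phi> g ` S \<inter> S \<noteq> {} \<longrightarrow> g \<in> Km) \<and>
      lie_subgroup Km K \<and>
      (\<exists>B W csec. principal_bundle K Km B \<and> openin (mtop B) W \<and> Km \<in> W \<and>
         smooth_map (submfd B W) (lmfd K) csec \<and> (\<forall>w\<in>W. csec w <#\<^bsub>K\<^esub> Km = w) \<and>
         (\<exists>Q. openin (mtop M) Q \<and> m \<in> Q \<and>
            diffeomorphism (prod_mfd (submfd B W) (submfd M S)) (submfd M Q)
              (\<lambda>(w, s). \<phi> (csec w) s))) \<and>
      (let Z = {s \<in> S. \<exists>g\<in>carrier K. stabilizer K \<phi> s = g <#\<^bsub>K\<^esub> Km #>\<^bsub>K\<^esub> (inv\<^bsub>K\<^esub> g)} in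
         submanifold (submfd M S) Z \<and> closedin (mtop (submfd M S)) Z) \<and>
      (\<exists>(X :: 'x set) \<sigma> U \<iota>. continuous_representation (sub_lie K Km) X \<sigma> \<and>
         openin (top_of_set X) U \<and> 0 \<in> U \<and> invariant_under (sub_lie K Km) \<sigma> U \<and>
         diffeomorphism (open_mfd X U) (submfd M S) \<iota> \<and>
         equivariant_on (sub_lie K Km) U \<sigma> \<phi> \<iota> \<and> \<iota> 0 = m))"


section \<open>Equivariant normal forms\<close>

definition abstract_normal_form ::
  "('g, 'e::locally_convex_space) lie \<Rightarrow>
   'x::locally_convex_space set \<Rightarrow> 'x set \<Rightarrow> 'x set \<Rightarrow> ('g \<Rightarrow> 'x \<Rightarrow> 'x) \<Rightarrow>
   'y::locally_convex_space set \<Rightarrow> 'y set \<Rightarrow> 'y set \<Rightarrow> ('g \<Rightarrow> 'y \<Rightarrow> 'y) \<Rightarrow>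
   ('x \<Rightarrow> 'y) \<Rightarrow> 'x set \<Rightarrow> ('x \<Rightarrow> 'y) \<Rightarrow> bool" where
  "abstract_normal_form H X Ker Coim \<sigma> Y Coker Img \<tau> fhat U fsing \<longleftrightarrow>
     compact_lie_group H \<and>
     linear_action H X \<sigma> \<and> topological_direct_sum X Ker Coim \<and>
     invariant_under H \<sigma> Ker \<and> invariant_under H \<sigma> Coim \<and>
     linear_action H Y \<tau> \<and> topological_direct_sum Y Coker Img \<and>
     invariant_under H \<tau> Coker \<and> invariant_under H \<tau> Img \<and>
     linear_between Coim Img fhat \<and> homeomorphic_map (top_of_set Coim) (top_of_set Img) fhat \<and>
     equivariant_on H Coim \<sigma> \<tau> fhat \<and>
     openin (top_of_set X) U \<and> 0 \<in> U \<and> invariant_under H \<sigma> U \<and>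
     smooth_on X Coker U fsing \<and> equivariant_on H U \<sigma> \<tau> fsing \<and>
     (\<forall>x\<in>U \<inter> Coim. fsing x = 0) \<and>
     (\<forall>v\<in>X. iter_deriv fsing [v] 0 = 0)"

text \<open>
  The associated bundle \<open>K \<times>\<^sub>H A\<close>: classes \<open>[g, a]\<close> under \<open>(g, a) \<sim> (g h, h\<inverse> \<cdot> a)\<close>. Maps out of it are
  given on representatives; \<open>the_elem\<close> picks their common value on a class.
\<close>

definition assoc_class ::
  "('g, 'e) lie \<Rightarrow> 'g set \<Rightarrow> ('g \<Rightarrow> 'a \<Rightarrow> 'a) \<Rightarrow> 'g \<Rightarrow> 'a \<Rightarrow> ('g \<times> 'a) set" where
  "assoc_class K H \<alpha> g a = {(g \<otimes>\<^bsub>K\<^esub> h, \<alpha> (inv\<^bsub>K\<^esub> h) a) | h. h \<in> H}"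

definition assoc_bundle ::
  "('g, 'e) lie \<Rightarrow> 'g set \<Rightarrow> ('g \<Rightarrow> 'a \<Rightarrow> 'a) \<Rightarrow> 'a set \<Rightarrow> ('g \<times> 'a) set set" where
  "assoc_bundle K H \<alpha> A = {assoc_class K H \<alpha> g a | g a. g \<in> carrier K \<and> a \<in> A}"

text \<open>\<open>[g, a] \<mapsto> [g, F a]\<close>\<close>

definition assoc_map ::
  "('g, 'e) lie \<Rightarrow> 'g set \<Rightarrow> ('g \<Rightarrow> 'b \<Rightarrow> 'b) \<Rightarrow> ('a \<Rightarrow> 'b) \<Rightarrow> ('g \<times> 'a) set \<Rightarrow> ('g \<times> 'b) set" where
  "assoc_map K H \<beta> F c = the_elem ((\<lambda>(g, a). assoc_class K H \<beta> g (F a)) ` c)"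

text \<open>\<open>[g, a] \<mapsto> g \<cdot> j a\<close>\<close>

definition tube_map :: "('g \<Rightarrow> 'm \<Rightarrow> 'm) \<Rightarrow> ('a \<Rightarrow> 'm) \<Rightarrow> ('g \<times> 'a) set \<Rightarrow> 'm" where
  "tube_map \<phi> j c = the_elem ((\<lambda>(g, a). \<phi> g (j a)) ` c)"

definition normal_form_map ::
  "('g, 'e) lie \<Rightarrow> 'g set \<Rightarrow> ('g \<Rightarrow> 'y \<Rightarrow> 'y) \<Rightarrow> 'x::real_vector set \<Rightarrow> 'x set \<Rightarrow>
   ('x \<Rightarrow> 'y::real_vector) \<Rightarrow> ('x \<Rightarrow> 'y) \<Rightarrow> ('g \<times> 'x) set \<Rightarrow> ('g \<times> 'y) set" where
  "normal_form_map K H \<tau> Ker Coim fhat fsing =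
     assoc_map K H \<tau> (\<lambda>x. fhat (second_component Ker Coim x) + fsing x)"

text \<open>
  \<open>normal_form_at TYPE('x) TYPE('y) G M \<phi> N \<psi> f \<mu> m\<close>: \<open>f\<close> can be brought into an equivariant normal
  form at \<open>m\<close>, with \<open>X\<close> and \<open>Y\<close> linear subspaces of \<open>'x\<close> and \<open>'y\<close>. The stabilizer of \<open>m\<close> in \<open>K = G\<^sub>\<mu>\<close>
  equals \<open>G\<^sub>m\<close> because \<open>f\<close> is equivariant. As \<open>\<rho>\<^sup>T\<close> is only defined on \<open>K \<times>\<^sub>H V\<close>, the normal form map has
  to take its values there for the composition to make sense.
\<close>

definition normal_form_at ::
  "'x::locally_convex_space itself \<Rightarrow> 'y::locally_convex_space itself \<Rightarrow>
   ('g, 'e::locally_convex_space) lie \<Rightarrow>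
   ('m, 'a::locally_convex_space) mfd \<Rightarrow> ('g \<Rightarrow> 'm \<Rightarrow> 'm) \<Rightarrow>
   ('n, 'b::locally_convex_space) mfd \<Rightarrow> ('g \<Rightarrow> 'n \<Rightarrow> 'n) \<Rightarrow>
   ('m \<Rightarrow> 'n) \<Rightarrow> 'n \<Rightarrow> 'm \<Rightarrow> bool" where
  "normal_form_at _ _ G M \<phi> N \<psi> f \<mu> m \<longleftrightarrow>
     (let K = sub_lie G (stabilizer G \<psi> \<mu>); Km = stabilizer K \<phi> m; H = sub_lie K Km in
      \<exists>(X :: 'x set) Ker Coim \<sigma> (Y :: 'y set) Coker Img \<tau> fhat U fsing S \<iota> V' V \<rho>.
        abstract_normal_form H X Ker Coim \<sigma> Y Coker Img \<tau> fhat U fsing \<and>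
        slice TYPE('x) K M \<phi> m S \<and>
        diffeomorphism (open_mfd X U) (submfd M S) \<iota> \<and> equivariant_on H U \<sigma> \<phi> \<iota> \<and>
        openin (mtop N) V' \<and> \<mu> \<in> V' \<and> invariant_under H \<psi> V' \<and>
        openin (top_of_set Y) V \<and> diffeomorphism (submfd N V') (open_mfd Y V) \<rho> \<and>
        equivariant_on H V' \<psi> \<tau> \<rho> \<and> \<rho> \<mu> = 0 \<and>
        f ` S \<subseteq> V' \<and>
        (\<forall>c\<in>assoc_bundle K Km \<sigma> U.
           normal_form_map K Km \<tau> Ker Coim fhat fsing c \<in> assoc_bundle K Km \<tau> V \<and>
           f (tube_map \<phi> (\<lambda>s. s) (assoc_map K Km \<phi> \<iota> c)) =
             tube_map \<psi> (inv_into V' \<rho>) (normal_form_map K Km \<tau> Ker Coim fhat fsing c)))"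

definition fibre :: "('m, 'e) mfd \<Rightarrow> ('m \<Rightarrow> 'n) \<Rightarrow> 'n \<Rightarrow> 'm set" where
  "fibre M f \<mu> = {x \<in> mpoints M. f x = \<mu>}"

text \<open>\<open>f\<^sup>-\<^sup>1(\<mu>)/G\<^sub>\<mu>\<close> with the quotient topology\<close>

definition reduced_space ::
  "('g, 'e::locally_convex_space) lie \<Rightarrow> ('m, 'a) mfd \<Rightarrow> ('g \<Rightarrow> 'm \<Rightarrow> 'm) \<Rightarrow>
   ('g \<Rightarrow> 'n \<Rightarrow> 'n) \<Rightarrow> ('m \<Rightarrow> 'n) \<Rightarrow> 'n \<Rightarrow> 'm set topology" where
  "reduced_space G M \<phi> \<psi> f \<mu> =
     orbit_space (subtopology (mtop M) (fibre M f \<mu>)) (sub_lie G (stabilizer G \<psi> \<mu>)) \<phi>"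

end

theory Submission
  imports Defs
begin

text \<open>
  Let \<open>K\<close> be the stabilizer of \<open>\<mu>\<close>, \<open>m\<close> a point of the fibre, \<open>H\<close> the stabilizer of \<open>m\<close> in \<open>K\<close>, and
  \<open>\<Phi> x = fhat x\<^sub>2 + fsing x\<close> the normal form of \<open>f\<close> at \<open>m\<close>, where \<open>x\<^sub>2\<close> is the component of \<open>x\<close> in
  \<open>Coim\<close>. On the slice \<open>S\<close>, parametrized by \<open>\<iota>: U \<rightarrow> S\<close>, the map \<open>f\<close> is \<open>\<Phi>\<close> read in the chart \<open>\<rho>\<close>
  (\<open>normal_form_on_slice\<close>), so \<open>\<iota> x\<close> lies in the fibre iff \<open>\<Phi> x = 0\<close>. Since \<open>fhat\<close> is injective and
  takes its values in a complement of \<open>Coker\<close>, this means \<open>x \<in> Ker\<close> and \<open>fsing x = 0\<close>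
  (\<open>normal_form_zero_iff\<close>). The Kuranishi chart therefore has domain \<open>U \<inter> Ker\<close>, obstruction space
  \<open>Coker\<close>, obstruction map \<open>fsing\<close>, group \<open>H\<close>, and \<open>\<kappa>\<close> sends the \<open>H\<close>-orbit of a zero \<open>z\<close> to the
  \<open>K\<close>-orbit of \<open>\<iota> z\<close>.

  That \<open>\<kappa>\<close> is a homeomorphism onto an open set uses only topological properties of the slice
  (\<open>orbit_space_local_model\<close>). It is injective because an element of \<open>K\<close> which moves a point of \<open>S\<close>
  into \<open>S\<close> lies in \<open>H\<close>. It is open, with open image, because the \<open>K\<close>-saturation of an open
  subset of \<open>S\<close> is open in \<open>M\<close> (\<open>slice_saturation_open\<close>), which in turn follows from the local product
  structure \<open>W \<times> S\<close> near \<open>m\<close>.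

  A Kuranishi chart asks for continuous representations, whereas \<open>H\<close> acts on the model spaces of a
  normal form only linearly. Continuity is inherited from the manifolds: near the origin the linear
  actions are conjugate to the actions of \<open>H\<close> on \<open>S\<close> and on a neighbourhood of \<open>\<mu>\<close>, and a linear action
  which is continuous near the origin is continuous (\<open>linear_action_continuous_from_local_model\<close>).
\<close>

section \<open>Group actions\<close>

context group_action
begin

lemma is_group: "group G"
  using group_hom group_hom.axioms(1) by blast

lemma one_acts_trivially: "x \<in> E \<Longrightarrow> \<phi> \<one> x = x"
  by (metis id_eq_one restrict_apply')

lemma orbit_eq_iff:
  assumes "x \<in> E" "y \<in> E"
  shows "orbit G \<phi> x = orbit G \<phi> y \<longleftrightarrow> (\<exists>g\<in>carrier G. y = \<phi> g x)"
proof
  assume "orbit G \<phi> x = orbit G \<phi> y"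
  with orbit_refl[OF assms(2)] show "\<exists>g\<in>carrier G. y = \<phi> g x"
    by (auto simp: orbit_def)
next
  assume "\<exists>g\<in>carrier G. y = \<phi> g x"
  then have y: "y \<in> orbit G \<phi> x" by (auto simp: orbit_def)
  then have x: "x \<in> orbit G \<phi> y" using assms orbit_sym by blast
  have inE: "z \<in> E" if "w \<in> E" "z \<in> orbit G \<phi> w" for z w
    using that element_image by (auto simp: orbit_def)
  show "orbit G \<phi> x = orbit G \<phi> y"
    using orbit_trans assms x y inE by blast
qed

text \<open>
  The elements of \<open>BijGroup A\<close> are extensional functions, so the action on an invariant subset \<open>A\<close> has
  to be cut off outside \<open>A\<close>.
\<close>

lemma restrict_to_invariant_subset:
  assumes "A \<subseteq> E" and inv: "\<And>g. g \<in> carrier G \<Longrightarrow> \<phi> g ` A \<subseteq> A"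
  shows "group_action G A (\<lambda>g. restrict (\<phi> g) A)"
proof -
  interpret G: group G by (rule is_group)
  have bij: "restrict (\<phi> g) A \<in> Bij A" if g: "g \<in> carrier G" for g
  proof -
    have "a \<in> \<phi> g ` A" if "a \<in> A" for a
    proof -
      have "\<phi> (inv g) a \<in> A" using inv[of "inv g"] g that by auto
      moreover have "\<phi> g (\<phi> (inv g) a) = a"
        using composition_rule[of a g "inv g"] g that assms(1) one_acts_trivially by auto
      ultimately show ?thesis by (metis imageI)
    qed
    then have "bij_betw (\<phi> g) A A"
      using inv[OF g] inj_prop[OF g] assms(1) by (auto simp: bij_betw_def intro: inj_on_subset)
    then show ?thesis
      by (simp add: Bij_def bij_betw_cong[of A "restrict (\<phi> g) A" "\<phi> g"])
  qed
  have "restrict (\<phi> (g \<otimes> h)) A = compose A (restrict (\<phi> g) A) (restrict (\<phi> h) A)"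
    if "g \<in> carrier G" "h \<in> carrier G" for g h
  proof (rule ext)
    fix a
    show "restrict (\<phi> (g \<otimes> h)) A a = compose A (restrict (\<phi> g) A) (restrict (\<phi> h) A) a"
      using that inv[of h] assms(1) composition_rule[of a g h]
      by (cases "a \<in> A") (auto simp: compose_def)
  qed
  then have "(\<lambda>g. restrict (\<phi> g) A) \<in> hom G (BijGroup A)"
    using bij by (auto simp: hom_def BijGroup_def)
  then show ?thesis
    by (simp add: group_action_def group_hom_def group_hom_axioms_def group_BijGroup is_group)
qed

end

lemma carrier_sub_lie [simp]: "carrier (sub_lie G H) = H"
  and mult_sub_lie [simp]: "mult (sub_lie G H) = mult G"
  and one_sub_lie [simp]: "one (sub_lie G H) = one G"
  and ltop_sub_lie [simp]: "ltop (sub_lie G H) = subtopology (ltop G) H"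
  by (simp_all add: sub_lie_def submfd_def)

lemma group_sub_lie:
  assumes "group G" "subgroup H G"
  shows "group (sub_lie G H)"
proof -
  interpret G: group G by fact
  interpret H: subgroup H G by fact
  show ?thesis
    by (rule groupI) (auto simp: G.m_assoc intro!: bexI[of _ "inv\<^bsub>G\<^esub> x" for x])
qed

lemma group_action_sub_lie:
  assumes "group_action G E \<phi>" "subgroup H G"
  shows "group_action (sub_lie G H) E \<phi>"
proof -
  interpret group_action G E \<phi> by fact
  have "\<phi> \<in> hom G (BijGroup E)" using group_hom group_hom.homh by blast
  then have "\<phi> \<in> hom (sub_lie G H) (BijGroup E)"
    using subgroup.subset[OF assms(2)] by (auto simp: hom_def)
  then show ?thesis
    by (simp add: group_action_def group_hom_def group_hom_axioms_def group_BijGroup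
        group_sub_lie is_group assms(2))
qed

lemma continuous_map_action:
  assumes "g_manifold G M \<phi>"
  shows "continuous_map (prod_topology (ltop G) (mtop M)) (mtop M) (\<lambda>(g, x). \<phi> g x)"
  using assms by (simp add: g_manifold_def smooth_map_def prod_mfd_def)

section \<open>Continuity of linear actions\<close>

lemma continuous_map_scaleR_subspace:
  fixes X :: "'x::locally_convex_space set"
  assumes "subspace X"
  shows "continuous_map (top_of_set X) (top_of_set X) (\<lambda>x. r *\<^sub>R x)"
proof -
  have "continuous_on X (\<lambda>x. r *\<^sub>R x)"
    unfolding continuous_on_def by (auto intro: tendsto_scaleR_lcs tendsto_ident_at)
  then show ?thesis using subspace_scale[OF assms] by (auto simp: Pi_iff)
qed

lemma open_nhd_of_zero_absorbing:
  fixes X :: "'x::locally_convex_space set"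
  assumes "openin (top_of_set X) U" "0 \<in> U" "subspace X" "x \<in> X"
  obtains t :: real where "t > 0" "t *\<^sub>R x \<in> U"
proof -
  obtain O' where O': "open O'" "U = X \<inter> O'" using assms(1) by (auto simp: openin_open)
  have "((\<lambda>t::real. t *\<^sub>R x) \<longlongrightarrow> 0 *\<^sub>R x) (at_right 0)"
    by (intro tendsto_scaleR_lcs tendsto_ident_at tendsto_const)
  then have "\<forall>\<^sub>F t in at_right (0::real). t *\<^sub>R x \<in> O'"
    using O' assms(2) topological_tendstoD by fastforce
  moreover have "\<forall>\<^sub>F t in at_right (0::real). t > 0"
    by (simp add: eventually_at_right_less)
  ultimately have "\<forall>\<^sub>F t in at_right (0::real). t > 0 \<and> t *\<^sub>R x \<in> O'"
    by eventually_elim auto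
  then obtain t :: real where "t > 0" "t *\<^sub>R x \<in> O'"
    using eventually_happens trivial_limit_at_right_real by blast
  then show ?thesis using that O' subspace_scale[OF assms(3,4)] by auto
qed

text \<open>
  Every point of \<open>X\<close> is carried into \<open>U\<close> by a homothety, and homotheties commute with linear maps:
  \<open>\<sigma> h x = (1 / t) \<sigma> h (t x)\<close>. Hence a family of linear maps is jointly continuous as soon as it is so
  near the origin.
\<close>

lemma linear_family_continuous_if_near_zero:
  fixes X :: "'x::locally_convex_space set"
  assumes X: "subspace X" and U: "openin (top_of_set X) U" "0 \<in> U"
    and lin: "\<And>h. h \<in> topspace T \<Longrightarrow> linear_between X X (\<sigma> h)"
    and cont: "continuous_map (prod_topology T (top_of_set U)) (top_of_set X) (\<lambda>(h, x). \<sigma> h x)"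
  shows "continuous_map (prod_topology T (top_of_set X)) (top_of_set X) (\<lambda>(h, x). \<sigma> h x)"
proof -
  let ?P = "prod_topology T (top_of_set X)"
  define D where "D t = {x \<in> X. t *\<^sub>R x \<in> U}" for t :: real
  show ?thesis
  proof (rule pasting_lemma[where I = "{0<..}" and T = "\<lambda>t. topspace T \<times> D t"
          and f = "\<lambda>_. \<lambda>(h, x). \<sigma> h x"])
    fix t :: real assume "t \<in> {0<..}"
    then have t: "t > 0" by simp
    have "openin (top_of_set X) (D t)"
      using openin_continuous_map_preimage[OF continuous_map_scaleR_subspace[OF X] U(1)]
      by (simp add: D_def)
    then show "openin ?P (topspace T \<times> D t)"
      by (simp add: openin_prod_Times_iff)
    have D: "D t \<subseteq> X" by (auto simp: D_def)
    have scale: "continuous_map (top_of_set (D t)) (top_of_set U) (\<lambda>x. t *\<^sub>R x)"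
      using continuous_map_from_subtopology[OF continuous_map_scaleR_subspace[OF X], of "D t" t] D
      by (auto simp: D_def subtopology_subtopology Int_absorb1)
    have "continuous_map (prod_topology T (top_of_set (D t))) (top_of_set X)
        ((\<lambda>x. (1 / t) *\<^sub>R x) \<circ> ((\<lambda>(h, x). \<sigma> h x) \<circ> (\<lambda>(h, x). (h, t *\<^sub>R x))))"
      by (intro continuous_map_compose[OF continuous_map_compose[OF _ cont]]
          continuous_map_scaleR_subspace X continuous_map_prod_top[THEN iffD2] disjI2 conjI scale)
         simp
    then have "continuous_map (prod_topology T (top_of_set (D t))) (top_of_set X) (\<lambda>(h, x). \<sigma> h x)"
    proof (rule continuous_map_eq)
      fix p assume "p \<in> topspace (prod_topology T (top_of_set (D t)))"
      then obtain h x where p: "p = (h, x)" "h \<in> topspace T" "x \<in> X" using D by auto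
      then show "((\<lambda>x. (1 / t) *\<^sub>R x) \<circ> ((\<lambda>(h, x). \<sigma> h x) \<circ> (\<lambda>(h, x). (h, t *\<^sub>R x)))) p
          = (case p of (h, x) \<Rightarrow> \<sigma> h x)"
        using lin[OF p(2)] t by (simp add: linear_between_def)
    qed
    moreover have "subtopology ?P (topspace T \<times> D t) = prod_topology T (top_of_set (D t))"
      using D by (simp add: subtopology_Times subtopology_subtopology Int_absorb1)
    ultimately show "continuous_map (subtopology ?P (topspace T \<times> D t)) (top_of_set X)
        (\<lambda>(h, x). \<sigma> h x)"
      by simp
  next
    fix p assume "p \<in> topspace ?P"
    then obtain h x where p: "p = (h, x)" "h \<in> topspace T" "x \<in> X" by auto
    obtain t :: real where "t > 0" "t *\<^sub>R x \<in> U"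
      using open_nhd_of_zero_absorbing[OF U X p(3)] .
    with p show "\<exists>t. t \<in> {0<..} \<and> p \<in> topspace T \<times> D t \<and>
        (case p of (h, x) \<Rightarrow> \<sigma> h x) = (case p of (h, x) \<Rightarrow> \<sigma> h x)"
      by (auto simp: D_def)
  qed auto
qed

lemma transported_action_continuous:
  assumes homeo: "homeomorphic_maps Q (subtopology P S) i j"
    and cont: "continuous_map (prod_topology T P) P (\<lambda>(h, p). \<phi> h p)"
    and S: "\<And>h p. h \<in> topspace T \<Longrightarrow> p \<in> S \<Longrightarrow> \<phi> h p \<in> S"
    and \<sigma>: "\<And>h x. h \<in> topspace T \<Longrightarrow> x \<in> topspace Q \<Longrightarrow> \<sigma> h x = j (\<phi> h (i x))"
  shows "continuous_map (prod_topology T Q) Q (\<lambda>(h, x). \<sigma> h x)"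
proof -
  have i: "continuous_map Q (subtopology P S) i" and j: "continuous_map (subtopology P S) Q j"
    using homeo by (auto simp: homeomorphic_maps_def)
  have "continuous_map (prod_topology T (subtopology P S)) P (\<lambda>(h, p). \<phi> h p)"
    using continuous_map_from_subtopology[OF cont, of "topspace T \<times> S"]
    by (simp add: subtopology_Times)
  then have "continuous_map (prod_topology T (subtopology P S)) (subtopology P S) (\<lambda>(h, p). \<phi> h p)"
    using S by (auto simp: continuous_map_in_subtopology)
  moreover have "continuous_map (prod_topology T Q) (prod_topology T (subtopology P S))
      (\<lambda>(h, x). (h, i x))"
    using i by (simp add: continuous_map_prod_top)
  ultimately have "continuous_map (prod_topology T Q) Q
      (j \<circ> ((\<lambda>(h, p). \<phi> h p) \<circ> (\<lambda>(h, x). (h, i x))))"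
    using j by (intro continuous_map_compose)
  then show ?thesis
    by (rule continuous_map_eq) (auto simp: \<sigma>)
qed

text \<open>
  A linear action need not be continuous. It is so when some neighbourhood of the origin is
  equivariantly homeomorphic to an invariant subset of a space on which the group acts continuously.
\<close>

lemma linear_action_continuous_from_local_model:
  fixes X :: "'x::locally_convex_space set"
  assumes lin: "linear_action H X \<sigma>" and top: "topspace (ltop H) = carrier H"
    and U: "openin (top_of_set X) U" "0 \<in> U"
    and homeo: "homeomorphic_maps (top_of_set U) (subtopology P S) i j"
    and cont: "continuous_map (prod_topology (ltop H) P) P (\<lambda>(h, p). \<phi> h p)"
    and S: "\<And>h p. h \<in> carrier H \<Longrightarrow> p \<in> S \<Longrightarrow> \<phi> h p \<in> S"
    and \<sigma>: "\<And>h x. h \<in> carrier H \<Longrightarrow> x \<in> U \<Longrightarrow> \<sigma> h x = j (\<phi> h (i x))"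
  shows "continuous_representation H X \<sigma>"
proof -
  have "continuous_map (prod_topology (ltop H) (top_of_set U)) (top_of_set U) (\<lambda>(h, x). \<sigma> h x)"
    using transported_action_continuous[OF homeo cont, of \<sigma>] S \<sigma> top by simp
  then have "continuous_map (prod_topology (ltop H) (top_of_set U)) (top_of_set X) (\<lambda>(h, x). \<sigma> h x)"
    using openin_imp_subset[OF U(1)] unfolding continuous_map_in_subtopology Pi_iff by blast
  then show ?thesis
    using linear_family_continuous_if_near_zero[of X U "ltop H" \<sigma>] lin U top
    by (auto simp: continuous_representation_def linear_action_def)
qed

lemma continuous_representation_restrict:
  fixes X :: "'x::locally_convex_space set"
  assumes rep: "continuous_representation H X \<sigma>" and top: "topspace (ltop H) = carrier H"
    and A: "subspace A" "A \<subseteq> X" and inv: "invariant_under H \<sigma> A"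
  shows "continuous_representation H A (\<lambda>h. restrict (\<sigma> h) A)"
proof -
  have act: "group_action H X \<sigma>" and lin: "\<And>h. h \<in> carrier H \<Longrightarrow> linear_between X X (\<sigma> h)"
    and cont: "continuous_map (prod_topology (ltop H) (top_of_set X)) (top_of_set X) (\<lambda>(h, x). \<sigma> h x)"
    using rep by (auto simp: continuous_representation_def linear_action_def)
  have inv': "\<sigma> h ` A \<subseteq> A" if "h \<in> carrier H" for h
    using inv that by (auto simp: invariant_under_def)
  have "linear_between A A (restrict (\<sigma> h) A)" if h: "h \<in> carrier H" for h
  proof -
    have "\<sigma> h (x + y) = \<sigma> h x + \<sigma> h y" "\<sigma> h (r *\<^sub>R x) = r *\<^sub>R \<sigma> h x" if "x \<in> A" "y \<in> A" for x y r
      using lin[OF h] subsetD[OF A(2) that(1)] subsetD[OF A(2) that(2)]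
      unfolding linear_between_def by blast+
    then show ?thesis
      using inv'[OF h] subspace_add[OF A(1)] subspace_scale[OF A(1)] by (auto simp: linear_between_def)
  qed
  moreover have "group_action H A (\<lambda>h. restrict (\<sigma> h) A)"
    using group_action.restrict_to_invariant_subset[OF act A(2)] inv' by blast
  moreover have "continuous_map (prod_topology (ltop H) (top_of_set A)) (top_of_set A)
      (\<lambda>(h, x). restrict (\<sigma> h) A x)"
  proof -
    have "prod_topology (ltop H) (top_of_set A)
        = subtopology (prod_topology (ltop H) (top_of_set X)) (topspace (ltop H) \<times> A)"
      using A(2) by (simp add: subtopology_Times subtopology_subtopology Int_absorb1)
    then have "continuous_map (prod_topology (ltop H) (top_of_set A)) (top_of_set X) (\<lambda>(h, x). \<sigma> h x)"
      using continuous_map_from_subtopology[OF cont] by simp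
    then have "continuous_map (prod_topology (ltop H) (top_of_set A)) euclidean (\<lambda>(h, x). \<sigma> h x)"
      by (rule continuous_map_into_fulltopology)
    then have "continuous_map (prod_topology (ltop H) (top_of_set A)) (top_of_set A) (\<lambda>(h, x). \<sigma> h x)"
      using inv' top by (auto simp: continuous_map_in_subtopology)
    then show ?thesis
      by (rule continuous_map_eq) auto
  qed
  ultimately show ?thesis
    using A(1) by (simp add: continuous_representation_def linear_action_def)
qed

section \<open>Smooth maps\<close>

lemma smooth_on_subset:
  assumes "smooth_on X F U f" "E \<subseteq> X" "V \<subseteq> U"
  shows "smooth_on E F V f"
  unfolding smooth_on_def
proof (intro conjI allI impI)
  show "f ` V \<subseteq> F" using assms by (auto simp: smooth_on_def)
next
  fix vs x v assume "set vs \<subseteq> E \<and> x \<in> V \<and> v \<in> E"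
  then have "set vs \<subseteq> X \<and> x \<in> U \<and> v \<in> X" using assms(2,3) by auto
  then show "\<exists>l\<in>F. ((\<lambda>t. (1 / t) *\<^sub>R (iter_deriv f vs (x + t *\<^sub>R v) - iter_deriv f vs x)) \<longlongrightarrow> l) (at (0::real))"
    using assms(1) by (auto simp: smooth_on_def)
next
  fix n
  have "V \<times> {v. \<forall>i. v i \<in> E} \<subseteq> U \<times> {v :: nat \<Rightarrow> 'a. \<forall>i. v i \<in> X}"
    using assms(2,3) by auto
  then show "continuous_on (V \<times> {v :: nat \<Rightarrow> 'a. \<forall>i. v i \<in> E})
      (\<lambda>(x, v). iter_deriv f (map v [0..<n]) x)"
    using assms(1) continuous_on_subset unfolding smooth_on_def by blast
qed

lemma diffeomorphism_imp_homeomorphic_maps: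
  assumes "diffeomorphism M N f"
  shows "homeomorphic_maps (mtop M) (mtop N) f (inv_into (mpoints M) f)"
  using assms
  by (auto simp: diffeomorphism_def smooth_map_def homeomorphic_maps_def bij_betw_def
      f_inv_into_f)

section \<open>Slices\<close>

text \<open>
  The map \<open>(w, s) \<mapsto> csec w \<cdot> s\<close> sends \<open>W \<times> S'\<close> onto an open set \<open>O'\<close> of \<open>M\<close>. All of \<open>O'\<close> lies in the
  saturation of \<open>S'\<close>, and the translates of \<open>O'\<close> exhaust that saturation.
\<close>

lemma slice_saturation_open:
  fixes M :: "('m, 'f::locally_convex_space) mfd"
    and K :: "('g, 'e::locally_convex_space) lie"
  assumes act: "group_action K (mpoints M) \<phi>" and top: "topspace (ltop K) = carrier K"
    and cont: "\<And>g. g \<in> carrier K \<Longrightarrow> continuous_map (mtop M) (mtop M) (\<phi> g)"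
    and slice: "slice TYPE('x::locally_convex_space) K M \<phi> m S"
    and S': "openin (subtopology (mtop M) S) S'"
  shows "openin (mtop M) (\<Union>g\<in>carrier K. \<phi> g ` S')"
proof -
  interpret group_action K "mpoints M" \<phi> by (rule act)
  interpret K: group K by (rule is_group)
  let ?Km = "stabilizer K \<phi> m"
  have section_ex: "\<exists>B W csec. principal_bundle K ?Km B \<and> openin (mtop B) W \<and> ?Km \<in> W \<and>
         smooth_map (submfd B W) (lmfd K) csec \<and> (\<forall>w\<in>W. csec w <#\<^bsub>K\<^esub> ?Km = w) \<and>
         (\<exists>Q. openin (mtop M) Q \<and> m \<in> Q \<and>
            diffeomorphism (prod_mfd (submfd B W) (submfd M S)) (submfd M Q)
              (\<lambda>(w, s). \<phi> (csec w) s))"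
    using slice unfolding slice_def Let_def by (elim conjE)
  from section_ex obtain B :: "('g set, 'e) mfd" and W csec Q where W: "openin (mtop B) W" "?Km \<in> W"
    and csec: "smooth_map (submfd B W) (lmfd K) csec"
    and Q: "openin (mtop M) Q"
    and dif: "diffeomorphism (prod_mfd (submfd B W) (submfd M S)) (submfd M Q)
              (\<lambda>(w, s). \<phi> (csec w) s)"
    by blast
  have S'M: "S' \<subseteq> mpoints M" and S'S: "S' \<subseteq> S"
    using openin_subset[OF S'] by auto
  have csecK: "csec w \<in> carrier K" if "w \<in> W" for w
  proof -
    have "csec ` topspace (subtopology (mtop B) W) \<subseteq> topspace (ltop K)"
      using csec continuous_map_image_subset_topspace by (fastforce simp: smooth_map_def submfd_def)
    then show ?thesis using that openin_subset[OF W(1)] top by auto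
  qed
  let ?d = "\<lambda>(w, s). \<phi> (csec w) s"
  have homeo: "homeomorphic_map (prod_topology (subtopology (mtop B) W) (subtopology (mtop M) S))
      (subtopology (mtop M) Q) ?d"
    using diffeomorphism_imp_homeomorphic_maps[OF dif]
    by (auto simp: homeomorphic_map_maps prod_mfd_def submfd_def)
  have "openin (subtopology (mtop B) W) W"
    using W(1) by (simp add: openin_open_subtopology)
  then have "openin (prod_topology (subtopology (mtop B) W) (subtopology (mtop M) S)) (W \<times> S')"
    using S' by (simp add: openin_prod_Times_iff)
  then have "openin (subtopology (mtop M) Q) (?d ` (W \<times> S'))"
    using homeo homeomorphic_map_openness_eq by blast
  then have "openin (mtop M) (?d ` (W \<times> S'))"
    using Q openin_trans_full by blast
  then obtain O' where O': "openin (mtop M) O'" and O'_def: "O' = ?d ` (W \<times> S')" by blast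
  have "openin (mtop M) (\<phi> g ` O')" if g: "g \<in> carrier K" for g
  proof -
    have "\<phi> g ` O' = {x \<in> mpoints M. \<phi> (inv\<^bsub>K\<^esub> g) x \<in> O'}"
    proof (intro equalityI subsetI)
      fix x assume "x \<in> \<phi> g ` O'"
      then obtain y where y: "y \<in> O'" "x = \<phi> g y" by blast
      then have "y \<in> mpoints M" using openin_subset[OF O'] by blast
      then show "x \<in> {x \<in> mpoints M. \<phi> (inv\<^bsub>K\<^esub> g) x \<in> O'}"
        using y orbit_sym_aux[OF g, of y x] element_image[OF g, of y x] by simp
    next
      fix x assume x: "x \<in> {x \<in> mpoints M. \<phi> (inv\<^bsub>K\<^esub> g) x \<in> O'}"
      then have "\<phi> (inv\<^bsub>K\<^esub> g) x \<in> O'" and "x = \<phi> g (\<phi> (inv\<^bsub>K\<^esub> g) x)"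
        using orbit_sym_aux[of "inv\<^bsub>K\<^esub> g" x] g by auto
      then show "x \<in> \<phi> g ` O'" by (intro image_eqI)
    qed
    then show ?thesis
      using openin_continuous_map_preimage[OF cont O', of "inv\<^bsub>K\<^esub> g"] g by simp
  qed
  then have "openin (mtop M) (\<Union>g\<in>carrier K. \<phi> g ` O')" by blast
  moreover have "(\<Union>g\<in>carrier K. \<phi> g ` O') = (\<Union>g\<in>carrier K. \<phi> g ` S')"
  proof (intro equalityI subsetI)
    fix x assume "x \<in> (\<Union>g\<in>carrier K. \<phi> g ` O')"
    then obtain g w s where *: "g \<in> carrier K" "w \<in> W" "s \<in> S'" "x = \<phi> g (\<phi> (csec w) s)"
      by (auto simp: O'_def)
    then have "x = \<phi> (g \<otimes>\<^bsub>K\<^esub> csec w) s"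
      using composition_rule[of s g "csec w"] csecK S'M by auto
    then show "x \<in> (\<Union>g\<in>carrier K. \<phi> g ` S')" using * csecK by blast
  next
    fix x assume "x \<in> (\<Union>g\<in>carrier K. \<phi> g ` S')"
    then obtain g s where *: "g \<in> carrier K" "s \<in> S'" "x = \<phi> g s" by auto
    \<comment> \<open>At the base point the section may take a value \<open>k\<close> other than the unit, so that \<open>O'\<close> contains
      \<open>k \<cdot> S'\<close> but not necessarily \<open>S'\<close>; translating by \<open>k\<inverse>\<close> recovers \<open>S'\<close>.\<close>
    define k where "k = csec ?Km"
    have k: "k \<in> carrier K" using csecK W(2) by (simp add: k_def)
    have ks: "\<phi> k s \<in> O'" using *(2) W(2) by (auto simp: k_def O'_def)
    have "\<phi> (g \<otimes>\<^bsub>K\<^esub> inv\<^bsub>K\<^esub> k) (\<phi> k s) = \<phi> g (\<phi> (inv\<^bsub>K\<^esub> k) (\<phi> k s))"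
      using composition_rule[of "\<phi> k s" g "inv\<^bsub>K\<^esub> k"] k *(1) openin_subset[OF O'] ks by auto
    also have "\<dots> = x" using orbit_sym_aux[OF k, of s] * S'M by auto
    finally show "x \<in> (\<Union>g\<in>carrier K. \<phi> g ` O')"
      using ks k *(1) by (intro UN_I[of "g \<otimes>\<^bsub>K\<^esub> inv\<^bsub>K\<^esub> k"]) (auto intro!: image_eqI[of x _ "\<phi> k s"])
  qed
  ultimately show ?thesis by simp
qed

section \<open>Orbit spaces\<close>

text \<open>
  An \<open>H\<close>-space \<open>Z\<close> homeomorphic to the part of \<open>F\<close> in a slice \<open>S\<close> models \<open>F/K\<close> locally. Continuity of
  the induced map \<open>\<kappa>\<close> comes from the universal property of the quotient \<open>Z/H\<close>, openness from the
  saturation property \<open>sat\<close>, injectivity from \<open>meet\<close>. As all points of a class of \<open>Z/H\<close> have images in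
  the same \<open>K\<close>-orbit, the union over the class in the definition of \<open>\<kappa>\<close> is that orbit; this avoids
  choosing representatives.
\<close>

lemma orbit_space_local_model:
  fixes T :: "'m topology" and Z :: "'x topology"
  assumes K: "group_action K (topspace T) \<phi>"
    and F: "F \<subseteq> topspace T" "\<And>g x. g \<in> carrier K \<Longrightarrow> x \<in> F \<Longrightarrow> \<phi> g x \<in> F"
    and S: "S \<subseteq> topspace T"
    and H: "carrier H \<subseteq> carrier K"
    and meet: "\<And>g s. g \<in> carrier K \<Longrightarrow> s \<in> S \<Longrightarrow> \<phi> g s \<in> S \<Longrightarrow> g \<in> carrier H"
    and sat: "\<And>S'. openin (subtopology T S) S' \<Longrightarrow> openin T (\<Union>g\<in>carrier K. \<phi> g ` S')"
    and HE: "group_action H E \<sigma>"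
    and Z: "topspace Z \<subseteq> E" "\<And>h z. h \<in> carrier H \<Longrightarrow> z \<in> topspace Z \<Longrightarrow> \<sigma> h z \<in> topspace Z"
    and \<iota>: "homeomorphic_map Z (subtopology T (S \<inter> F)) \<iota>"
    and equi: "\<And>h z. h \<in> carrier H \<Longrightarrow> z \<in> topspace Z \<Longrightarrow> \<iota> (\<sigma> h z) = \<phi> h (\<iota> z)"
  defines "A \<equiv> orbit K \<phi> ` (S \<inter> F)" and "R \<equiv> orbit_space (subtopology T F) K \<phi>"
    and "\<kappa> \<equiv> \<lambda>c. \<Union>z\<in>c. orbit K \<phi> (\<iota> z)"
  shows "openin R A" "homeomorphic_map (orbit_space Z H \<sigma>) (subtopology R A) \<kappa>"
proof -
  interpret K: group_action K "topspace T" \<phi> by (rule K)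
  interpret KG: group K by (rule K.is_group)
  interpret H: group_action H E \<sigma> by (rule HE)
  let ?p = "orbit K \<phi>" and ?q = "orbit H \<sigma>"
  have topR: "topspace R = ?p ` F"
    using F(1) by (simp add: R_def topspace_quotient_topology Int_absorb1)
  have pq: "quotient_map (subtopology T F) R ?p" and qq: "quotient_map Z (orbit_space Z H \<sigma>) ?q"
    by (simp_all add: R_def quotient_map_quotient_topology)
  have \<iota>im: "\<iota> ` topspace Z = S \<inter> F"
    using homeomorphic_imp_surjective_map[OF \<iota>] F(1) by auto
  \<comment> \<open>Applied twice: with \<open>S' = S\<close> it shows that the image \<open>A\<close> is open, with smaller \<open>S'\<close> that \<open>\<kappa>\<close> is an
    open map.\<close>
  have open_image: "openin R (?p ` (S' \<inter> F))" if S': "openin (subtopology T S) S'" for S'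
  proof -
    have S'T: "S' \<subseteq> topspace T" using openin_subset[OF S'] by auto
    have "{x \<in> topspace (subtopology T F). ?p x \<in> ?p ` (S' \<inter> F)} = (\<Union>g\<in>carrier K. \<phi> g ` S') \<inter> F"
      (is "?L = ?Rhs")
    proof (intro equalityI subsetI)
      fix x assume "x \<in> ?L"
      then obtain s where s: "x \<in> F" "s \<in> S'" "?p s = ?p x" by force
      then obtain g where "g \<in> carrier K" "x = \<phi> g s"
        using K.orbit_eq_iff[of s x] F(1) S'T by auto
      then show "x \<in> ?Rhs" using s by auto
    next
      fix x assume "x \<in> ?Rhs"
      then obtain g s where gs: "g \<in> carrier K" "s \<in> S'" "x = \<phi> g s" "x \<in> F" by auto
      have "s = \<phi> (inv\<^bsub>K\<^esub> g) x" using K.orbit_sym_aux[OF gs(1), of s x] gs S'T by auto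
      then have "s \<in> F" using F(2)[of "inv\<^bsub>K\<^esub> g" x] gs by simp
      moreover have "?p s = ?p x" using K.orbit_eq_iff[of s x] F(1) S'T gs by auto
      ultimately show "x \<in> ?L" using gs F(1) by auto
    qed
    then show ?thesis
      using sat[OF S'] F(1)
      by (auto simp: R_def openin_quotient_topology openin_subtopology)
  qed
  have S_open: "openin (subtopology T S) S"
    using S by (metis inf.absorb2 openin_topspace topspace_subtopology)
  show A: "openin R A" using open_image[OF S_open] by (simp add: A_def)
  have \<kappa>q: "\<kappa> (?q z) = ?p (\<iota> z)" if z: "z \<in> topspace Z" for z
  proof -
    have "?p (\<iota> (\<sigma> h z)) = ?p (\<iota> z)" if h: "h \<in> carrier H" for h
    proof -
      have "\<iota> z \<in> topspace T" "\<iota> (\<sigma> h z) \<in> topspace T" using \<iota>im z Z(2)[OF h z] S by auto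
      then have "?p (\<iota> z) = ?p (\<iota> (\<sigma> h z))"
        unfolding K.orbit_eq_iff[OF \<open>\<iota> z \<in> topspace T\<close> \<open>\<iota> (\<sigma> h z) \<in> topspace T\<close>]
        using equi[OF h z] h H by blast
      then show ?thesis by simp
    qed
    then have "(\<Union>h\<in>carrier H. ?p (\<iota> (\<sigma> h z))) = (\<Union>h\<in>carrier H. ?p (\<iota> z))" by simp
    moreover have "\<kappa> (?q z) = (\<Union>h\<in>carrier H. ?p (\<iota> (\<sigma> h z)))"
      by (auto simp: \<kappa>_def orbit_def[of H])
    moreover have "carrier H \<noteq> {}" using group.is_monoid[OF H.is_group] monoid.one_closed by blast
    ultimately show ?thesis by simp
  qed
  have topQ: "topspace (orbit_space Z H \<sigma>) = ?q ` topspace Z"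
    by (simp add: topspace_quotient_topology)
  have im: "\<kappa> ` topspace (orbit_space Z H \<sigma>) = A"
    unfolding topQ image_image A_def \<iota>im[symmetric] by (rule image_cong) (simp_all add: \<kappa>q)
  have AR: "A \<subseteq> topspace R" using openin_subset[OF A] .
  show "homeomorphic_map (orbit_space Z H \<sigma>) (subtopology R A) \<kappa>"
  proof (rule bijective_open_imp_homeomorphic_map)
    have "continuous_map Z (subtopology T F) \<iota>"
      using homeomorphic_imp_continuous_map[OF \<iota>] by (auto simp: continuous_map_in_subtopology)
    then have "continuous_map Z R (?p \<circ> \<iota>)"
      using continuous_map_compose quotient_imp_continuous_map[OF pq] by blast
    then have "continuous_map Z R (\<kappa> \<circ> ?q)"
      by (rule continuous_map_eq) (simp add: \<kappa>q)
    then have "continuous_map (orbit_space Z H \<sigma>) R \<kappa>"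
      by (rule continuous_compose_quotient_map[OF qq])
    then show "continuous_map (orbit_space Z H \<sigma>) (subtopology R A) \<kappa>"
      using im by (auto simp: continuous_map_in_subtopology)
    show "\<kappa> ` topspace (orbit_space Z H \<sigma>) = topspace (subtopology R A)"
      using AR im by auto
    show "open_map (orbit_space Z H \<sigma>) (subtopology R A) \<kappa>"
      unfolding open_map_def
    proof (intro allI impI)
      fix W assume W: "openin (orbit_space Z H \<sigma>) W"
      define O' where "O' = {z \<in> topspace Z. ?q z \<in> W}"
      have O': "openin Z O'" and W': "W = ?q ` O'"
        using W by (auto simp: O'_def openin_quotient_topology)
      have "openin (subtopology T (S \<inter> F)) (\<iota> ` O')"
        using O' \<iota> homeomorphic_map_openness_eq by blast
      then obtain S' where "openin (subtopology T S) S'" "\<iota> ` O' = S' \<inter> F"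
        by (auto simp: subtopology_subtopology[symmetric] openin_subtopology)
      moreover have "\<kappa> ` W = ?p ` \<iota> ` O'"
        unfolding W' using \<kappa>q by (force simp: O'_def image_image)
      ultimately have "openin R (\<kappa> ` W)" using open_image by simp
      moreover have "\<kappa> ` W \<subseteq> A"
        using im openin_subset[OF W] by blast
      ultimately show "openin (subtopology R A) (\<kappa> ` W)"
        using A by (simp add: openin_open_subtopology)
    qed
    show "inj_on \<kappa> (topspace (orbit_space Z H \<sigma>))"
    proof (rule inj_onI)
      fix c c' assume "c \<in> topspace (orbit_space Z H \<sigma>)" "c' \<in> topspace (orbit_space Z H \<sigma>)"
        and eq: "\<kappa> c = \<kappa> c'"
      then obtain z z' where z: "z \<in> topspace Z" "z' \<in> topspace Z" "c = ?q z" "c' = ?q z'"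
        by (auto simp: topQ)
      have S: "\<iota> z \<in> S" "\<iota> z' \<in> S" using z \<iota>im by auto
      obtain g where g: "g \<in> carrier K" "\<iota> z' = \<phi> g (\<iota> z)"
        using eq K.orbit_eq_iff[of "\<iota> z" "\<iota> z'"] S \<open>S \<subseteq> topspace T\<close> z by (auto simp: \<kappa>q)
      then have h: "g \<in> carrier H" using meet S by metis
      then have "\<iota> z' = \<iota> (\<sigma> g z)" using g equi z(1) by simp
      then have "z' = \<sigma> g z"
        using homeomorphic_imp_injective_map[OF \<iota>] z Z(2)[OF h z(1)] by (meson inj_onD)
      then show "c = c'" using H.orbit_eq_iff[of z z'] z Z(1) h by auto
    qed
  qed
qed

section \<open>Associated bundles\<close>

text \<open>
  Independence of the representative: the pair \<open>(g h, h\<inverse> b)\<close> has the same class as \<open>(g, b)\<close>. This makes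
  \<open>assoc_map\<close> well defined on classes, and with it the formulas
  \<open>[g, a] \<mapsto> [g, F a]\<close> and \<open>[g, a] \<mapsto> g \<cdot> j a\<close> below.
\<close>

lemma assoc_class_shift:
  assumes K: "group K" and H: "subgroup H K" and act: "group_action (sub_lie K H) B \<beta>"
    and g: "g \<in> carrier K" and h: "h \<in> H" and b: "b \<in> B"
  shows "assoc_class K H \<beta> (g \<otimes>\<^bsub>K\<^esub> h) (\<beta> (inv\<^bsub>K\<^esub> h) b) = assoc_class K H \<beta> g b"
proof -
  interpret K: group K by fact
  interpret H: subgroup H K by fact
  interpret act: group_action "sub_lie K H" B \<beta> by fact
  have comp: "(g \<otimes>\<^bsub>K\<^esub> h \<otimes>\<^bsub>K\<^esub> k, \<beta> (inv\<^bsub>K\<^esub> k) (\<beta> (inv\<^bsub>K\<^esub> h) b)) =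
      (g \<otimes>\<^bsub>K\<^esub> (h \<otimes>\<^bsub>K\<^esub> k), \<beta> (inv\<^bsub>K\<^esub> (h \<otimes>\<^bsub>K\<^esub> k)) b)" if k: "k \<in> H" for k
    using act.composition_rule[of b "inv\<^bsub>K\<^esub> k" "inv\<^bsub>K\<^esub> h"] g h k b
    by (simp add: K.m_assoc K.inv_mult_group)
  have "bij_betw (\<lambda>k. h \<otimes>\<^bsub>K\<^esub> k) H H"
    by (rule bij_betw_byWitness[where f' = "\<lambda>k. inv\<^bsub>K\<^esub> h \<otimes>\<^bsub>K\<^esub> k"])
       (use h in \<open>auto simp: K.m_assoc[symmetric]\<close>)
  then have HH: "H = (\<lambda>k. h \<otimes>\<^bsub>K\<^esub> k) ` H" by (simp add: bij_betw_def)
  have "assoc_class K H \<beta> g b =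
      (\<lambda>k. (g \<otimes>\<^bsub>K\<^esub> k, \<beta> (inv\<^bsub>K\<^esub> k) b)) ` (\<lambda>k. h \<otimes>\<^bsub>K\<^esub> k) ` H"
    unfolding HH[symmetric] by (auto simp: assoc_class_def)
  also have "\<dots> = (\<lambda>k. (g \<otimes>\<^bsub>K\<^esub> h \<otimes>\<^bsub>K\<^esub> k, \<beta> (inv\<^bsub>K\<^esub> k) (\<beta> (inv\<^bsub>K\<^esub> h) b))) ` H"
    unfolding image_image by (rule image_cong) (use comp in simp_all)
  also have "\<dots> = assoc_class K H \<beta> (g \<otimes>\<^bsub>K\<^esub> h) (\<beta> (inv\<^bsub>K\<^esub> h) b)"
    by (auto simp: assoc_class_def)
  finally show ?thesis by simp
qed

lemma the_elem_image_assoc_class: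
  assumes "group K" "subgroup H K" "\<And>h. h \<in> H \<Longrightarrow> F (g \<otimes>\<^bsub>K\<^esub> h, \<alpha> (inv\<^bsub>K\<^esub> h) a) = c"
  shows "the_elem (F ` assoc_class K H \<alpha> g a) = c"
proof -
  have "\<one>\<^bsub>K\<^esub> \<in> H" using assms(2) by (rule subgroup.one_closed)
  then have "F ` assoc_class K H \<alpha> g a = {c}"
    using assms(3) by (force simp: assoc_class_def)
  then show ?thesis by simp
qed

lemma assoc_map_assoc_class:
  assumes K: "group K" and H: "subgroup H K" and act: "group_action (sub_lie K H) B \<beta>"
    and g: "g \<in> carrier K" and Fa: "F a \<in> B" and equi: "\<And>h. h \<in> H \<Longrightarrow> F (\<alpha> h a) = \<beta> h (F a)"
  shows "assoc_map K H \<beta> F (assoc_class K H \<alpha> g a) = assoc_class K H \<beta> g (F a)"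
  unfolding assoc_map_def
proof (rule the_elem_image_assoc_class[OF K H])
  fix h assume h: "h \<in> H"
  then have "inv\<^bsub>K\<^esub> h \<in> H" by (rule subgroup.m_inv_closed[OF H])
  then show "(case (g \<otimes>\<^bsub>K\<^esub> h, \<alpha> (inv\<^bsub>K\<^esub> h) a) of (g, a) \<Rightarrow> assoc_class K H \<beta> g (F a)) =
      assoc_class K H \<beta> g (F a)"
    using assoc_class_shift[OF K H act g h Fa] equi by simp
qed

lemma tube_map_assoc_class:
  assumes act: "group_action K P \<phi>" and H: "subgroup H K"
    and g: "g \<in> carrier K" and ja: "j a \<in> P" and equi: "\<And>h. h \<in> H \<Longrightarrow> j (\<alpha> h a) = \<phi> h (j a)"
  shows "tube_map \<phi> j (assoc_class K H \<alpha> g a) = \<phi> g (j a)"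
proof -
  interpret group_action K P \<phi> by fact
  interpret K: group K by (rule is_group)
  show ?thesis
    unfolding tube_map_def
  proof (rule the_elem_image_assoc_class[OF is_group H])
    fix h assume h: "h \<in> H"
    then have hK: "h \<in> carrier K" and invH: "inv\<^bsub>K\<^esub> h \<in> H"
      using H by (auto dest: subgroup.mem_carrier subgroup.m_inv_closed)
    have "\<phi> (g \<otimes>\<^bsub>K\<^esub> h) (\<phi> (inv\<^bsub>K\<^esub> h) (j a)) = \<phi> (g \<otimes>\<^bsub>K\<^esub> h \<otimes>\<^bsub>K\<^esub> inv\<^bsub>K\<^esub> h) (j a)"
      using composition_rule[OF ja, of "g \<otimes>\<^bsub>K\<^esub> h" "inv\<^bsub>K\<^esub> h"] g hK by simp
    also have "\<dots> = \<phi> g (j a)" using g hK by (simp add: K.m_assoc)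
    finally show "(case (g \<otimes>\<^bsub>K\<^esub> h, \<alpha> (inv\<^bsub>K\<^esub> h) a) of (g, a) \<Rightarrow> \<phi> g (j a)) = \<phi> g (j a)"
      using equi[OF invH] by simp
  qed
qed

text \<open>
  The normal form map is only known to take its values in the bundle over the chart domain \<open>V\<close>. As \<open>V\<close>
  is invariant, every representative of a class in that bundle has its second entry in \<open>V\<close>.
\<close>

lemma assoc_class_in_bundle_imp_mem:
  assumes K: "group K" and H: "subgroup H K" and act: "group_action (sub_lie K H) B \<beta>"
    and "b \<in> B" and V: "\<And>h v. h \<in> H \<Longrightarrow> v \<in> V \<Longrightarrow> \<beta> h v \<in> V"
    and mem: "assoc_class K H \<beta> g b \<in> assoc_bundle K H \<beta> V"
  shows "b \<in> V"
proof -
  interpret K: group K by fact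
  obtain g' v where v: "v \<in> V" "assoc_class K H \<beta> g b = assoc_class K H \<beta> g' v"
    using mem by (auto simp: assoc_bundle_def)
  have "\<beta> \<one>\<^bsub>K\<^esub> b = b"
    using group_action.one_acts_trivially[OF act \<open>b \<in> B\<close>] by simp
  then have "(g \<otimes>\<^bsub>K\<^esub> \<one>\<^bsub>K\<^esub>, b) \<in> assoc_class K H \<beta> g b"
    using subgroup.one_closed[OF H] by (force simp: assoc_class_def)
  then obtain h where "h \<in> H" "b = \<beta> (inv\<^bsub>K\<^esub> h) v"
    unfolding v(2) by (auto simp: assoc_class_def)
  then show ?thesis using V v(1) subgroup.m_inv_closed[OF H] by blast
qed

section \<open>Normal forms\<close>

lemma topological_direct_sum_subsets:
  assumes "topological_direct_sum X A B"
  shows "A \<subseteq> X" "B \<subseteq> X"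
proof -
  have 0: "0 \<in> A" "0 \<in> B" and im: "(\<lambda>(a, b). a + b) ` (A \<times> B) = X"
    using assms homeomorphic_imp_surjective_map
    by (fastforce simp: topological_direct_sum_def subspace_0)+
  have "a + 0 \<in> X" if "a \<in> A" for a using im that 0 by blast
  then show "A \<subseteq> X" by auto
  have "0 + b \<in> X" if "b \<in> B" for b using im that 0 by blast
  then show "B \<subseteq> X" by auto
qed

lemma direct_sum_cancel:
  assumes "topological_direct_sum X A B" "a \<in> A" "b \<in> B" "a' \<in> A" "b' \<in> B" "a + b = a' + b'"
  shows "a = a'" "b = b'"
proof -
  have "inj_on (\<lambda>(a, b). a + b) (A \<times> B)"
    using assms(1) homeomorphic_imp_injective_map by (fastforce simp: topological_direct_sum_def)
  then have "(a, b) = (a', b')"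
    using assms(2-) by (intro inj_onD[of "\<lambda>(a, b). a + b" "A \<times> B"]) auto
  then show "a = a'" "b = b'" by auto
qed

lemma second_component_add:
  assumes "topological_direct_sum X A B" "a \<in> A" "b \<in> B"
  shows "second_component A B (a + b) = b"
  unfolding second_component_def
proof (rule the_equality)
  show "b \<in> B \<and> a + b - b \<in> A" using assms by simp
  fix b' assume "b' \<in> B \<and> a + b - b' \<in> A"
  then show "b' = b"
    using direct_sum_cancel(2)[OF assms(1), of "a + b - b'" b' a b] assms(2,3) by simp
qed

lemma direct_sum_decomposition:
  assumes "topological_direct_sum X A B" "x \<in> X"
  obtains a b where "a \<in> A" "b \<in> B" "x = a + b"
proof -
  have "(\<lambda>(a, b). a + b) ` (A \<times> B) = X"
    using assms(1) homeomorphic_imp_surjective_map by (fastforce simp: topological_direct_sum_def)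
  then have "x \<in> (\<lambda>(a, b). a + b) ` (A \<times> B)" using assms(2) by simp
  then show ?thesis using that by auto
qed

context
  fixes H :: "('g, 'e::locally_convex_space) lie"
    and X Ker Coim :: "'x::locally_convex_space set" and \<sigma> :: "'g \<Rightarrow> 'x \<Rightarrow> 'x"
    and Y Coker Img :: "'y::locally_convex_space set" and \<tau> :: "'g \<Rightarrow> 'y \<Rightarrow> 'y"
    and fhat fsing :: "'x \<Rightarrow> 'y" and U :: "'x set" and \<Phi> :: "'x \<Rightarrow> 'y"
  assumes nf: "abstract_normal_form H X Ker Coim \<sigma> Y Coker Img \<tau> fhat U fsing"
  defines "\<Phi> \<equiv> \<lambda>x. fhat (second_component Ker Coim x) + fsing x"
begin

lemma normal_form_sums:
  shows "topological_direct_sum X Ker Coim" "topological_direct_sum Y Coker Img"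
  using nf by (simp_all add: abstract_normal_form_def)

lemma normal_form_decomposition:
  assumes "x \<in> U"
  obtains a b where "a \<in> Ker" "b \<in> Coim" "x = a + b" "\<Phi> x = fhat b + fsing x"
    "fhat b \<in> Img" "fsing x \<in> Coker"
proof -
  have "U \<subseteq> X" "fhat ` Coim \<subseteq> Img" "fsing ` U \<subseteq> Coker"
    using nf openin_imp_subset
    by (auto simp: abstract_normal_form_def linear_between_def smooth_on_def)
  moreover from this obtain a b where ab: "a \<in> Ker" "b \<in> Coim" "x = a + b"
    using direct_sum_decomposition[OF normal_form_sums(1)] assms by blast
  ultimately show ?thesis
    using that[OF ab] second_component_add[OF normal_form_sums(1) ab(1,2)] assms ab(2)
    by (auto simp: \<Phi>_def ab(3))
qed

lemma normal_form_closed: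
  assumes "x \<in> U"
  shows "\<Phi> x \<in> Y"
proof -
  have "subspace Y" using normal_form_sums(2) by (simp add: topological_direct_sum_def)
  moreover obtain a b where "\<Phi> x = fhat b + fsing x" "fhat b \<in> Img" "fsing x \<in> Coker"
    using normal_form_decomposition[OF assms] by metis
  ultimately show ?thesis
    using topological_direct_sum_subsets[OF normal_form_sums(2)] by (auto intro: subspace_add)
qed

text \<open>
  Both direct sums are invariant, so \<open>\<sigma> h\<close> commutes with the projection to \<open>Coim\<close>.
\<close>

lemma normal_form_equivariant:
  assumes h: "h \<in> carrier H" and x: "x \<in> U"
  shows "\<Phi> (\<sigma> h x) = \<tau> h (\<Phi> x)"
proof -
  obtain a b where ab: "a \<in> Ker" "b \<in> Coim" "x = a + b" "\<Phi> x = fhat b + fsing x"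
    and im: "fhat b \<in> Img" "fsing x \<in> Coker"
    using normal_form_decomposition[OF x] by metis
  note sub = topological_direct_sum_subsets[OF normal_form_sums(1)]
    topological_direct_sum_subsets[OF normal_form_sums(2)]
  have lin: "linear_between X X (\<sigma> h)" "linear_between Y Y (\<tau> h)"
    and inv: "\<sigma> h ` Ker \<subseteq> Ker" "\<sigma> h ` Coim \<subseteq> Coim"
    and equi: "fhat (\<sigma> h b) = \<tau> h (fhat b)" "fsing (\<sigma> h x) = \<tau> h (fsing x)"
    using nf h x ab(2)
    by (simp_all add: abstract_normal_form_def linear_action_def invariant_under_def equivariant_on_def)
  have \<sigma>: "\<sigma> h x = \<sigma> h a + \<sigma> h b"
    using lin(1) ab(1,2) sub unfolding ab(3) linear_between_def by blast
  have "second_component Ker Coim (\<sigma> h x) = \<sigma> h b"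
    unfolding \<sigma> using inv ab(1,2) by (intro second_component_add[OF normal_form_sums(1)]) auto
  then have "\<Phi> (\<sigma> h x) = \<tau> h (fhat b) + \<tau> h (fsing x)"
    by (simp add: \<Phi>_def equi)
  also have "\<dots> = \<tau> h (\<Phi> x)"
    using lin(2) im sub unfolding ab(4) linear_between_def by (metis subsetD)
  finally show ?thesis .
qed

text \<open>
  The two summands of \<open>\<Phi> x\<close> lie in the complementary subspaces \<open>Img\<close> and \<open>Coker\<close>, so if \<open>\<Phi> x = 0\<close> both
  vanish; injectivity of \<open>fhat\<close> then kills the component of \<open>x\<close> in \<open>Coim\<close>. This is the reduction of
  Lyapunov and Schmidt of the equation \<open>\<Phi> x = 0\<close> to an equation on \<open>Ker\<close> with values in \<open>Coker\<close>.
\<close>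

lemma normal_form_zero_iff:
  assumes x: "x \<in> U"
  shows "\<Phi> x = 0 \<longleftrightarrow> x \<in> Ker \<and> fsing x = 0"
proof -
  obtain a b where ab: "a \<in> Ker" "b \<in> Coim" "x = a + b" "\<Phi> x = fhat b + fsing x"
    and im: "fhat b \<in> Img" "fsing x \<in> Coker"
    using normal_form_decomposition[OF x] by metis
  have zero: "0 \<in> Ker" "0 \<in> Coim" "0 \<in> Coker" "0 \<in> Img"
    using normal_form_sums by (auto simp: topological_direct_sum_def subspace_0)
  have "inj_on fhat Coim"
    using nf homeomorphic_imp_injective_map[of "top_of_set Coim" "top_of_set Img" fhat]
    by (simp add: abstract_normal_form_def)
  moreover have fhat0: "fhat 0 = 0"
  proof -
    have "fhat (0 *\<^sub>R 0) = 0 *\<^sub>R fhat 0"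
      using nf zero(2) unfolding abstract_normal_form_def linear_between_def by blast
    then show ?thesis by simp
  qed
  ultimately have inj: "fhat b = 0 \<longleftrightarrow> b = 0"
    using ab(2) zero(2) by (metis inj_onD)
  have "\<Phi> x = fsing x + fhat b" unfolding ab(4) by (rule add.commute)
  then have "\<Phi> x = 0 \<longleftrightarrow> fsing x = 0 \<and> fhat b = 0"
    using direct_sum_cancel[OF normal_form_sums(2) im(2,1) zero(3,4)] by fastforce
  moreover have "x \<in> Ker \<longleftrightarrow> b = 0"
  proof
    assume "x \<in> Ker"
    then show "b = 0"
      using direct_sum_cancel(2)[OF normal_form_sums(1) ab(1,2) _ zero(2)] ab(3) by simp
  qed (use ab(1,3) in simp)
  ultimately show ?thesis using inj by blast
qed

end

section \<open>Kuranishi charts from normal forms\<close>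

lemma continuous_map_action_sub_lie:
  assumes "continuous_map (prod_topology (ltop G) P) Q f"
  shows "continuous_map (prod_topology (ltop (sub_lie G H)) P) Q f"
  using continuous_map_from_subtopology[OF assms, of "H \<times> topspace P"]
  by (simp add: subtopology_Times)

text \<open>
  On the slice the intertwining identity of the tube maps reads \<open>f \<circ> \<iota> = \<rho>\<inverse> \<circ> \<Phi>\<close>: evaluate it on the
  classes \<open>[e, x]\<close>. The conclusion is stated through \<open>\<rho>\<close> because \<open>\<rho>\<close> sends \<open>\<mu>\<close> to \<open>0\<close>, which turns the
  fibre over \<open>\<mu>\<close> into the zero set of \<open>\<Phi>\<close>.
\<close>

lemma normal_form_on_slice:
  assumes nf: "abstract_normal_form (sub_lie K Km) X Ker Coim \<sigma> Y Coker Img \<tau> fhat U fsing"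
    and M: "group_action K P \<phi>" and N: "group_action K Q \<psi>" and Km: "subgroup Km K"
    and \<iota>: "\<iota> ` U \<subseteq> P" "equivariant_on (sub_lie K Km) U \<sigma> \<phi> \<iota>"
    and V': "V' \<subseteq> Q" "invariant_under (sub_lie K Km) \<psi> V'"
    and \<rho>: "bij_betw \<rho> V' V" "equivariant_on (sub_lie K Km) V' \<psi> \<tau> \<rho>"
    and tubes: "\<forall>c\<in>assoc_bundle K Km \<sigma> U.
           normal_form_map K Km \<tau> Ker Coim fhat fsing c \<in> assoc_bundle K Km \<tau> V \<and>
           f (tube_map \<phi> (\<lambda>s. s) (assoc_map K Km \<phi> \<iota> c)) =
             tube_map \<psi> (inv_into V' \<rho>) (normal_form_map K Km \<tau> Ker Coim fhat fsing c)"
    and x: "x \<in> U"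
  shows "\<rho> (f (\<iota> x)) = fhat (second_component Ker Coim x) + fsing x"
proof -
  interpret M: group_action K P \<phi> by (rule M)
  interpret N: group_action K Q \<psi> by (rule N)
  interpret K: group K by (rule M.is_group)
  define \<Phi> where "\<Phi> = (\<lambda>x. fhat (second_component Ker Coim x) + fsing x)"
  let ?c = "assoc_class K Km \<sigma> \<one>\<^bsub>K\<^esub> x" and ?y = "assoc_class K Km \<tau> \<one>\<^bsub>K\<^esub> (\<Phi> x)"
  have actY: "group_action (sub_lie K Km) Y \<tau>"
    using nf by (simp add: abstract_normal_form_def linear_action_def)
  have \<rho>V: "\<rho> ` V' = V" "inj_on \<rho> V'" using \<rho>(1) by (auto simp: bij_betw_def)
  have inv_equi: "inv_into V' \<rho> (\<tau> h v) = \<psi> h (inv_into V' \<rho> v)" and V_inv: "\<tau> h v \<in> V"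
    if hv: "h \<in> Km" "v \<in> V" for h v
  proof -
    obtain p where p: "p \<in> V'" "v = \<rho> p" using hv(2) \<rho>V by auto
    have "\<psi> h p \<in> V'" "\<rho> (\<psi> h p) = \<tau> h v"
      using V'(2) \<rho>(2) hv(1) p by (auto simp: invariant_under_def equivariant_on_def)
    then show "inv_into V' \<rho> (\<tau> h v) = \<psi> h (inv_into V' \<rho> v)" "\<tau> h v \<in> V"
      using \<rho>V p by (auto simp: inv_into_f_f dest: sym)
  qed
  have \<Phi>Y: "\<Phi> x \<in> Y" and \<Phi>_equi: "\<And>h. h \<in> Km \<Longrightarrow> \<Phi> (\<sigma> h x) = \<tau> h (\<Phi> x)"
    using normal_form_closed[OF nf x] normal_form_equivariant[OF nf _ x] by (simp_all add: \<Phi>_def)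
  have nfc: "normal_form_map K Km \<tau> Ker Coim fhat fsing ?c = ?y"
    unfolding normal_form_map_def \<Phi>_def[symmetric]
    by (rule assoc_map_assoc_class[OF K.is_group Km actY]) (use \<Phi>Y \<Phi>_equi in auto)
  have c: "?c \<in> assoc_bundle K Km \<sigma> U" using x by (auto simp: assoc_bundle_def)
  have "?y \<in> assoc_bundle K Km \<tau> V" using tubes c nfc by metis
  then have \<Phi>V: "\<Phi> x \<in> V"
    using assoc_class_in_bundle_imp_mem[OF K.is_group Km actY \<Phi>Y] V_inv by blast
  have \<iota>x: "\<iota> x \<in> P" using \<iota>(1) x by blast
  have "assoc_map K Km \<phi> \<iota> ?c = assoc_class K Km \<phi> \<one>\<^bsub>K\<^esub> (\<iota> x)"
    by (rule assoc_map_assoc_class[OF K.is_group Km group_action_sub_lie[OF M Km]])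
       (use \<iota> x in \<open>auto simp: equivariant_on_def\<close>)
  moreover have "tube_map \<phi> (\<lambda>s. s) (assoc_class K Km \<phi> \<one>\<^bsub>K\<^esub> (\<iota> x)) = \<phi> \<one>\<^bsub>K\<^esub> (\<iota> x)"
    by (rule tube_map_assoc_class[OF M Km]) (use \<iota>x in auto)
  ultimately have lhs: "tube_map \<phi> (\<lambda>s. s) (assoc_map K Km \<phi> \<iota> ?c) = \<iota> x"
    using M.one_acts_trivially[OF \<iota>x] by simp
  have inQ: "inv_into V' \<rho> (\<Phi> x) \<in> Q"
    using inv_into_into[of "\<Phi> x" \<rho> V'] \<Phi>V \<rho>V V'(1) by auto
  have "tube_map \<psi> (inv_into V' \<rho>) ?y = \<psi> \<one>\<^bsub>K\<^esub> (inv_into V' \<rho> (\<Phi> x))"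
    by (rule tube_map_assoc_class[OF N Km]) (use inQ inv_equi \<Phi>V in auto)
  then have "f (\<iota> x) = inv_into V' \<rho> (\<Phi> x)"
    using tubes c nfc lhs N.one_acts_trivially[OF inQ] by metis
  then show ?thesis
    using \<Phi>V \<rho>V by (simp add: f_inv_into_f \<Phi>_def)
qed

theorem theorem3p2p3:
  fixes G :: "('g, 'eg::locally_convex_space) lie"
    and M :: "('m, 'em::locally_convex_space) mfd" and \<phi> :: "'g \<Rightarrow> 'm \<Rightarrow> 'm"
    and N :: "('n, 'en::locally_convex_space) mfd" and \<psi> :: "'g \<Rightarrow> 'n \<Rightarrow> 'n"
    and f :: "'m \<Rightarrow> 'n" and \<mu> :: 'n
  assumes "lie_group G"
    and "g_manifold G M \<phi>" and "g_manifold G N \<psi>"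
    and "smooth_map M N f" and "equivariant_on G (mpoints M) \<phi> \<psi> f"
    and "\<mu> \<in> mpoints N" and "fibre M f \<mu> \<noteq> {}"
    and "lie_subgroup (stabilizer G \<psi> \<mu>) G"
    and "\<forall>m\<in>fibre M f \<mu>.
           normal_form_at TYPE('x::locally_convex_space) TYPE('y::locally_convex_space)
             G M \<phi> N \<psi> f \<mu> m"
  shows "\<forall>q\<in>topspace (reduced_space G M \<phi> \<psi> f \<mu>).
           \<exists>V (E :: 'x set) (F :: 'y set) (H :: ('g, 'eg) lie) \<sigma> \<tau> s \<kappa>.
             kuranishi_chart (reduced_space G M \<phi> \<psi> f \<mu>) q V E F H \<sigma> \<tau> s \<kappa>"
proof
  fix q assume q: "q \<in> topspace (reduced_space G M \<phi> \<psi> f \<mu>)"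
  define K where "K = sub_lie G (stabilizer G \<psi> \<mu>)"
  let ?F = "fibre M f \<mu>"
  have FM: "?F \<subseteq> mpoints M" by (auto simp: fibre_def)
  have R: "reduced_space G M \<phi> \<psi> f \<mu> = orbit_space (subtopology (mtop M) ?F) K \<phi>"
    by (simp add: reduced_space_def K_def)
  obtain m where m: "m \<in> ?F" "q = orbit K \<phi> m"
    using q FM by (auto simp: R topspace_quotient_topology)
  have actG: "group_action G (mpoints M) \<phi>" "group_action G (mpoints N) \<psi>"
    using assms(2,3) by (simp_all add: g_manifold_def)
  have stab: "subgroup (stabilizer G \<psi> \<mu>) G"
    using assms(8) by (simp add: lie_subgroup_def)
  have KG: "carrier K \<subseteq> carrier G" using subgroup.subset[OF stab] by (simp add: K_def)
  have act: "group_action K (mpoints M) \<phi>" "group_action K (mpoints N) \<psi>"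
    unfolding K_def using actG stab by (auto intro: group_action_sub_lie)
  interpret actM: group_action K "mpoints M" \<phi> by (rule act)
  have topK: "topspace (ltop K) = carrier K"
    using assms(1) KG by (auto simp: lie_group_def K_def)
  have contK: "continuous_map (prod_topology (ltop K) (mtop M)) (mtop M) (\<lambda>(g, x). \<phi> g x)"
    "continuous_map (prod_topology (ltop K) (mtop N)) (mtop N) (\<lambda>(g, x). \<psi> g x)"
    unfolding K_def
    using continuous_map_action_sub_lie continuous_map_action[OF assms(2)]
      continuous_map_action[OF assms(3)] by blast+
  have cont1: "continuous_map (mtop M) (mtop M) (\<phi> g)" if g: "g \<in> carrier K" for g
  proof -
    have "continuous_map (mtop M) (prod_topology (ltop K) (mtop M)) (\<lambda>x. (g, x))"
      using g topK by (simp add: continuous_map_pairwise o_def)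
    from continuous_map_compose[OF this contK(1)] show ?thesis by (simp add: o_def)
  qed
  have Finv: "\<phi> g x \<in> ?F" if "g \<in> carrier K" "x \<in> ?F" for g x
    using that actM.element_image[of g x] assms(5) KG
    by (auto simp: fibre_def equivariant_on_def K_def stabilizer_def)

  define Km where "Km = stabilizer K \<phi> m"
  define H where "H = sub_lie K Km"
  have Km: "subgroup Km K"
    using actM.stabilizer_subgroup m(1) FM by (auto simp: Km_def)
  have HK: "carrier H \<subseteq> carrier K" "carrier H = Km"
    using subgroup.subset[OF Km] by (simp_all add: H_def)
  have topH: "topspace (ltop H) = carrier H"
    using topK HK by (auto simp: H_def)
  have contH: "continuous_map (prod_topology (ltop H) (mtop M)) (mtop M) (\<lambda>(g, x). \<phi> g x)"
    "continuous_map (prod_topology (ltop H) (mtop N)) (mtop N) (\<lambda>(g, x). \<psi> g x)"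
    unfolding H_def using contK continuous_map_action_sub_lie by blast+

  have "normal_form_at TYPE('x) TYPE('y) G M \<phi> N \<psi> f \<mu> m" using assms(9) m(1) by blast
  then obtain X Ker Coim :: "'x set" and \<sigma> and Y Coker Img :: "'y set"
      and \<tau> fhat U fsing S \<iota> V' V \<rho> where
    nf: "abstract_normal_form H X Ker Coim \<sigma> Y Coker Img \<tau> fhat U fsing" and
    slice: "slice TYPE('x) K M \<phi> m S" and
    \<iota>: "diffeomorphism (open_mfd X U) (submfd M S) \<iota>" "equivariant_on H U \<sigma> \<phi> \<iota>" and
    V': "openin (mtop N) V'" "\<mu> \<in> V'" "invariant_under H \<psi> V'" and
    V: "openin (top_of_set Y) V" and
    \<rho>: "diffeomorphism (submfd N V') (open_mfd Y V) \<rho>" "equivariant_on H V' \<psi> \<tau> \<rho>" "\<rho> \<mu> = 0" and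
    fS: "f ` S \<subseteq> V'" and
    tubes: "\<forall>c\<in>assoc_bundle K Km \<sigma> U.
           normal_form_map K Km \<tau> Ker Coim fhat fsing c \<in> assoc_bundle K Km \<tau> V \<and>
           f (tube_map \<phi> (\<lambda>s. s) (assoc_map K Km \<phi> \<iota> c)) =
             tube_map \<psi> (inv_into V' \<rho>) (normal_form_map K Km \<tau> Ker Coim fhat fsing c)"
    unfolding normal_form_at_def Let_def K_def[symmetric] Km_def[symmetric] H_def[symmetric]
    by (elim exE conjE) (rule that; assumption)

  have SM: "S \<subseteq> mpoints M" and mS: "m \<in> S"
    and SL1: "\<And>g. g \<in> Km \<Longrightarrow> \<phi> g ` S \<subseteq> S"
    and disjoint: "\<And>g. g \<in> carrier K \<Longrightarrow> \<phi> g ` S \<inter> S \<noteq> {} \<Longrightarrow> g \<in> Km"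
    using slice unfolding slice_def Let_def Km_def[symmetric] submanifold_def by simp_all
  have SL2: "g \<in> Km" if "g \<in> carrier K" "s \<in> S" "\<phi> g s \<in> S" for g s
    using disjoint[OF that(1)] that(2,3) by blast
  have V'N: "V' \<subseteq> mpoints N" using openin_subset[OF V'(1)] .
  have U: "openin (top_of_set X) U" "0 \<in> U" "\<And>h. h \<in> carrier H \<Longrightarrow> \<sigma> h ` U \<subseteq> U"
    and compact: "compact_lie_group H"
    and linX: "linear_action H X \<sigma>" and linY: "linear_action H Y \<tau>"
    and sums: "topological_direct_sum X Ker Coim" "topological_direct_sum Y Coker Img"
    and invKer: "invariant_under H \<sigma> Ker" and invCoker: "invariant_under H \<tau> Coker"
    and fsing: "smooth_on X Coker U fsing" "equivariant_on H U \<sigma> \<tau> fsing"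
    using nf by (simp_all add: abstract_normal_form_def invariant_under_def)
  have sub: "subspace Ker" "subspace Coker" "0 \<in> Ker"
    using sums by (auto simp: topological_direct_sum_def subspace_0)
  note subsets = topological_direct_sum_subsets[OF sums(1)] topological_direct_sum_subsets[OF sums(2)]

  have \<iota>_maps: "homeomorphic_maps (top_of_set U) (subtopology (mtop M) S) \<iota> (inv_into U \<iota>)"
    using diffeomorphism_imp_homeomorphic_maps[OF \<iota>(1)] by (simp add: open_mfd_def submfd_def)
  have \<iota>_bij: "bij_betw \<iota> U S"
    using \<iota>(1) SM by (simp add: diffeomorphism_def open_mfd_def submfd_def Int_absorb1)
  have \<rho>_maps: "homeomorphic_maps (subtopology (mtop N) V') (top_of_set V) \<rho> (inv_into V' \<rho>)"
    using diffeomorphism_imp_homeomorphic_maps[OF \<rho>(1)] V'N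
    by (simp add: open_mfd_def submfd_def Int_absorb1)
  have \<rho>_bij: "bij_betw \<rho> V' V"
    using \<rho>(1) V'N by (simp add: diffeomorphism_def open_mfd_def submfd_def Int_absorb1)
  have \<iota>_equi: "\<iota> (\<sigma> h x) = \<phi> h (\<iota> x)" if "h \<in> carrier H" "x \<in> U" for h x
    using \<iota>(2) that by (simp add: equivariant_on_def)

  \<comment> \<open>The continuous actions of \<open>H\<close> on \<open>S\<close> and on \<open>V'\<close> are carried to the model spaces by \<open>\<iota>\<close> and \<open>\<rho>\<close>.\<close>
  have repX: "continuous_representation H X \<sigma>"
  proof (rule linear_action_continuous_from_local_model[OF linX topH U(1,2) \<iota>_maps contH(1)])
    show "\<phi> h p \<in> S" if "h \<in> carrier H" "p \<in> S" for h p
      using SL1 that HK by blast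
    show "\<sigma> h x = inv_into U \<iota> (\<phi> h (\<iota> x))" if "h \<in> carrier H" "x \<in> U" for h x
    proof -
      have "\<sigma> h x \<in> U" using U(3) that by blast
      then show ?thesis
        using \<iota>_bij by (simp add: \<iota>_equi[OF that, symmetric] bij_betw_inv_into_left)
    qed
  qed
  have V0: "0 \<in> V" using \<rho>_bij V'(2) \<rho>(3) by (auto simp: bij_betw_def)
  have repY: "continuous_representation H Y \<tau>"
  proof (rule linear_action_continuous_from_local_model[OF linY topH V V0
        homeomorphic_maps_sym[THEN iffD1, OF \<rho>_maps] contH(2)])
    show "\<psi> h p \<in> V'" if "h \<in> carrier H" "p \<in> V'" for h p
      using V'(3) that by (auto simp: invariant_under_def)
    show "\<tau> h y = \<rho> (\<psi> h (inv_into V' \<rho> y))" if "h \<in> carrier H" "y \<in> V" for h y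
    proof -
      have "inv_into V' \<rho> y \<in> V'" "\<rho> (inv_into V' \<rho> y) = y"
        using \<rho>_bij that(2) by (auto simp: bij_betw_def inv_into_into f_inv_into_f)
      then show ?thesis using \<rho>(2) that(1) by (simp add: equivariant_on_def)
    qed
  qed

  \<comment> \<open>The zero set of the obstruction map, identified by \<open>\<iota>\<close> with the part of the fibre in \<open>S\<close>.\<close>
  define Z where "Z = {v \<in> U \<inter> Ker. fsing v = 0}"
  have f_iff: "f (\<iota> x) = \<mu> \<longleftrightarrow> x \<in> Z" if x: "x \<in> U" for x
  proof -
    have "\<iota> ` U \<subseteq> mpoints M" using \<iota>_bij SM by (auto simp: bij_betw_def)
    then have "\<rho> (f (\<iota> x)) = fhat (second_component Ker Coim x) + fsing x"
      using normal_form_on_slice[OF nf[unfolded H_def] act Km _ \<iota>(2)[unfolded H_def] V'N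
          V'(3)[unfolded H_def] \<rho>_bij \<rho>(2)[unfolded H_def] tubes x] by blast
    then have "\<rho> (f (\<iota> x)) = 0 \<longleftrightarrow> x \<in> Z"
      using normal_form_zero_iff[OF nf x] x by (auto simp: Z_def)
    moreover have "f (\<iota> x) \<in> V'" using fS \<iota>_bij x by (auto simp: bij_betw_def)
    ultimately show ?thesis
      using \<rho>_bij V'(2) \<rho>(3) unfolding bij_betw_def by (metis inj_onD)
  qed
  have ZU: "Z \<subseteq> U" "Z \<subseteq> Ker" by (auto simp: Z_def)
  have \<iota>Z: "\<iota> ` Z = S \<inter> ?F"
    using f_iff \<iota>_bij SM ZU(1) unfolding bij_betw_def fibre_def by blast
  have "homeomorphic_map (subtopology (top_of_set U) Z) (subtopology (subtopology (mtop M) S) ?F) \<iota>"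
  proof (rule homeomorphic_map_subtopologies)
    show "homeomorphic_map (top_of_set U) (subtopology (mtop M) S) \<iota>"
      using \<iota>_maps homeomorphic_map_maps by blast
    show "\<iota> ` (topspace (top_of_set U) \<inter> Z) = topspace (subtopology (mtop M) S) \<inter> ?F"
      using \<iota>Z ZU SM by (simp add: Int_absorb1)
  qed
  then have \<iota>_homeo: "homeomorphic_map (top_of_set Z) (subtopology (mtop M) (S \<inter> ?F)) \<iota>"
    using ZU by (simp add: subtopology_subtopology Int_absorb1)

  define \<sigma>' where "\<sigma>' = (\<lambda>h. restrict (\<sigma> h) Ker)"
  define \<tau>' where "\<tau>' = (\<lambda>h. restrict (\<tau> h) Coker)"
  have rep: "continuous_representation H Ker \<sigma>'" "continuous_representation H Coker \<tau>'"
    unfolding \<sigma>'_def \<tau>'_def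
    using continuous_representation_restrict[OF repX topH sub(1) subsets(1) invKer]
      continuous_representation_restrict[OF repY topH sub(2) subsets(3) invCoker] by auto
  have inv: "\<sigma>' h v \<in> U \<inter> Ker" "fsing (\<sigma>' h v) = \<tau>' h (fsing v)"
    if "h \<in> carrier H" "v \<in> U \<inter> Ker" for h v
  proof -
    have "\<sigma> h v \<in> U" "\<sigma> h v \<in> Ker" using U(3)[OF that(1)] invKer that
      unfolding invariant_under_def by blast+
    moreover have "fsing v \<in> Coker" using fsing(1) that by (auto simp: smooth_on_def)
    ultimately show "\<sigma>' h v \<in> U \<inter> Ker" "fsing (\<sigma>' h v) = \<tau>' h (fsing v)"
      using fsing(2) that by (auto simp: \<sigma>'_def \<tau>'_def equivariant_on_def)
  qed
  have \<tau>'0: "\<tau>' h 0 = 0" if "h \<in> carrier H" for h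
  proof -
    have "\<tau>' h (0 *\<^sub>R 0) = 0 *\<^sub>R \<tau>' h 0"
      using rep(2) that subspace_0[OF sub(2)]
      unfolding continuous_representation_def linear_action_def linear_between_def by blast
    then show ?thesis by simp
  qed
  have \<sigma>'Z: "\<sigma>' h z \<in> Z" "\<iota> (\<sigma>' h z) = \<phi> h (\<iota> z)" if "h \<in> carrier H" "z \<in> Z" for h z
  proof -
    have z: "z \<in> U \<inter> Ker" "fsing z = 0" using that(2) by (auto simp: Z_def)
    show "\<sigma>' h z \<in> Z" using inv[OF that(1) z(1)] z \<tau>'0[OF that(1)] by (simp add: Z_def)
    show "\<iota> (\<sigma>' h z) = \<phi> h (\<iota> z)" using \<iota>_equi[OF that(1)] z by (simp add: \<sigma>'_def)
  qed

  define A where "A = orbit K \<phi> ` (S \<inter> ?F)"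
  define \<kappa> where "\<kappa> = (\<lambda>c. \<Union>z\<in>c. orbit K \<phi> (\<iota> z))"
  have actKer: "group_action H Ker \<sigma>'"
    using rep(1) by (simp add: continuous_representation_def linear_action_def)
  have sat: "openin (mtop M) (\<Union>g\<in>carrier K. \<phi> g ` S')" if "openin (subtopology (mtop M) S) S'" for S'
    using slice_saturation_open[OF act(1) topK cont1 slice that] .
  have local_model: "openin (reduced_space G M \<phi> \<psi> f \<mu>) A"
    "homeomorphic_map (orbit_space (top_of_set Z) H \<sigma>') (subtopology (reduced_space G M \<phi> \<psi> f \<mu>) A) \<kappa>"
    unfolding R A_def \<kappa>_def
    using orbit_space_local_model[OF act(1) FM Finv SM HK(1) _ sat actKer _ _ \<iota>_homeo]
      SL2 HK(2) ZU(2) \<sigma>'Z by auto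
  have "kuranishi_chart (reduced_space G M \<phi> \<psi> f \<mu>) q (U \<inter> Ker) Ker Coker H \<sigma>' \<tau>' fsing \<kappa>"
    unfolding kuranishi_chart_def
  proof (intro conjI)
    show "openin (top_of_set Ker) (U \<inter> Ker)"
      using U(1) subsets(1) by (auto simp: openin_open)
    show "invariant_under H \<sigma>' (U \<inter> Ker)"
      unfolding invariant_under_def using inv(1) by blast
    show "smooth_on Ker Coker (U \<inter> Ker) fsing"
      using smooth_on_subset[OF fsing(1) subsets(1)] by blast
    show "equivariant_on H (U \<inter> Ker) \<sigma>' \<tau>' fsing"
      unfolding equivariant_on_def using inv(2) by blast
    \<comment> \<open>The point \<open>m\<close> lies in \<open>S\<close> and in the fibre, so it is \<open>\<iota> z\<close> for some zero \<open>z\<close>, which may differ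
      from \<open>0\<close>: the chart covers \<open>q\<close> without being centred at it.\<close>
    have "q \<in> A" using m mS by (simp add: A_def)
    then show "\<exists>A B. openin (reduced_space G M \<phi> \<psi> f \<mu>) B \<and> q \<in> B \<and> B \<subseteq> A \<and>
        A \<subseteq> topspace (reduced_space G M \<phi> \<psi> f \<mu>) \<and>
        homeomorphic_map (orbit_space (top_of_set {v \<in> U \<inter> Ker. fsing v = 0}) H \<sigma>')
          (subtopology (reduced_space G M \<phi> \<psi> f \<mu>) A) \<kappa>"
      using local_model openin_subset[OF local_model(1)] unfolding Z_def by blast
  qed (use U(2) sub compact rep in auto)
  then show "\<exists>V (E :: 'x set) (F :: 'y set) (H :: ('g, 'eg) lie) \<sigma> \<tau> s \<kappa>.
      kuranishi_chart (reduced_space G M \<phi> \<psi> f \<mu>) q V E F H \<sigma> \<tau> s \<kappa>"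
    by blast
qed

end
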